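(* Let $\Omega\subseteq\mathbb{R}^d$ be a nonempty closed convex set, and let $f:\mathbb{R}^d\to\mathbb{R}$ be convex and SPB with parameters $\mathrm{R}_1,\mathrm{R}_2,m$. Assume the problem $\min_{x\in\Omega}f(x)$ has an optimal solution $x^*$. Fix $\sigma>0$, $x^0\in\Omega$ and $\{\tau_k\}\subset(0,1]$, and generate $\{x^k\}$ by: for $k=0,1,2,\dots$, draw $u^k\sim\mathcal{N}(0,I)$ independently of the past, set $v^k=\sigma^{-1}[f(x^k+\sigma u^k)-f(x^k)]u^k$ and \[x^{k+1}=P_\Omega\Big(x^k-\tau_k\frac{v^k}{\|x^k\|^m+1}\Big).\] Then, with $\mathbb{E}$ denoting expectation over all the random vectors $u^0,u^1,\dots$, \[0\le\mathbb{E}[\|x^k-z\|^2]-\mathbb{E}[\|x^{k+1}-z\|^2]+\mathcal{H}_{(2)}\tau_k^2\qquad\forall z\in\mathop{\rm arg\,min}_{u\in\Omega}f_\sigma(u),\ \forall k\ge0,\] and for any integer $T>0$, \[\min_{0\le k\le T}\mathbb{E}\Big[\frac{f(x^k)-f(x^* )}{\|x^k\|^m+1}\Big]\le\frac{1}{2\sum_{k=0}^T\tau_k}\Big[\|x^0-x^*\|^2+\mathcal{H}_{(2)}\sum_{k=0}^T\tau_k^2\Big]+\mathcal{M}(x^* )\sigma,\] where $\mathcal{M}(x)=(2^{m-1}\mathrm{R}_1\|x\|^m+\mathrm{R}_2)\sqrt d+2^{m-1}\mathrm{R}_1\sigma^m(m+1+d)^{(m+1)/2}$ and $\mathcal{H}_{(2)}=3\max\big\{2^{2(m-1)}\mathrm{R}_1^2(4+d)^2,\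 \mathrm{R}_2^2(4+d)^2+2^{2(m-1)}\mathrm{R}_1^2\sigma^{2m}(2m+4+d)^{m+2}\big\}$.
   Context: $\mathcal{N}(0,I)$ is the $d$-dimensional standard Gaussian distribution; $\|\cdot\|$ the Euclidean norm; $P_\Omega$ the Euclidean projection onto $\Omega$. $f_\sigma(x)=\mathbb{E}_{u\sim\mathcal{N}(0,I)}[f(x+\sigma u)]$ is the Gaussian smoothing of $f$. $f$ is SPB with parameters $\mathrm{R}_1\ge0$, $\mathrm{R}_2>0$, integer $m\ge0$ (with $\mathrm{R}_1=0$ iff $m=0$) if $f$ is locally Lipschitz and $\sup_{\zeta\in\partial_Cf(x)}\|\zeta\|\le\mathrm{R}_1\|x\|^m+\mathrm{R}_2$ for all $x$, where $\partial_C f$ is the Clarke subdifferential (convention $0^0=1$). *)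

theory Defs
  imports "HOL-Analysis.Analysis" "HOL-Probability.Probability"
begin

definition locally_lipschitz :: "('a::metric_space \<Rightarrow> real) \<Rightarrow> bool" where
  "locally_lipschitz f \<longleftrightarrow> (\<forall>x. \<exists>e>0. \<exists>L. L-lipschitz_on (ball x e) f)"

definition clarke_dir_deriv :: "('a::real_normed_vector \<Rightarrow> real) \<Rightarrow> 'a \<Rightarrow> 'a \<Rightarrow> ereal" where
  "clarke_dir_deriv f x v =
     Limsup (at (x, 0) within (UNIV \<times> {0<..}))
       (\<lambda>(y, t::real). ereal ((f (y + t *\<^sub>R v) - f y) / t))"

definition clarke_subdiff :: "('a::real_inner \<Rightarrow> real) \<Rightarrow> 'a \<Rightarrow> 'a set" where
  "clarke_subdiff f x = {\<zeta>. \<forall>v. ereal (\<zeta> \<bullet> v) \<le> clarke_dir_deriv f x v}"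

text \<open>SPB functions with parameters R1, R2, m (convention 0^0 = 1 as in HOL).\<close>
definition SPB :: "('a::real_inner \<Rightarrow> real) \<Rightarrow> real \<Rightarrow> real \<Rightarrow> nat \<Rightarrow> bool" where
  "SPB f R1 R2 m \<longleftrightarrow> R1 \<ge> 0 \<and> R2 > 0 \<and> (R1 = 0 \<longleftrightarrow> m = 0) \<and> locally_lipschitz f \<and>
     (\<forall>x. \<forall>\<zeta>\<in>clarke_subdiff f x. norm \<zeta> \<le> R1 * norm x ^ m + R2)"

definition std_gauss :: "(real^'d) measure" where
  "std_gauss = density lborel
     (\<lambda>x. ennreal ((2 * pi) powr (- real CARD('d) / 2) * exp (- (norm x)\<^sup>2 / 2)))"

definition gauss_smooth :: "(real^'d \<Rightarrow> real) \<Rightarrow> real \<Rightarrow> real^'d \<Rightarrow> real" where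
  "gauss_smooth f \<sigma> x = (\<integral>u. f (x + \<sigma> *\<^sub>R u) \<partial>std_gauss)"

definition gauss_seq :: "(nat \<Rightarrow> real^'d) measure" where
  "gauss_seq = PiM UNIV (\<lambda>_. std_gauss)"

end

theory Submission
  imports Defs
begin

text \<open>
  For convex \<open>f\<close> every subgradient is a Clarke subgradient, so the SPB bound gives
  \<open>|f (x + \<sigma> u) - f x| \<le> (c |x|^m + R2 + c \<sigma>^m |u|^m) \<sigma> |u|\<close> with \<open>c = 2^(m-1) R1\<close>.
  Together with the Gaussian moment bounds this yields \<open>f \<le> f_\<sigma> \<le> f + M \<sigma>\<close> and
  \<open>E |v|\<^sup>2 \<le> H (|x|^m + 1)\<^sup>2\<close>. Moreover \<open>E v\<close> is a subgradient of the convex function \<open>f_\<sigma>\<close>, so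
  nonexpansiveness of the projection gives, conditionally on the past,
  \<open>E |x' - z|\<^sup>2 \<le> |x - z|\<^sup>2 - 2 \<tau> (f_\<sigma> x - f_\<sigma> z) / (|x|^m + 1) + H \<tau>\<^sup>2\<close>.
  The first claim drops the nonnegative gap; the second takes \<open>z = x*\<close>, replaces \<open>f_\<sigma>\<close> by \<open>f\<close>
  at the cost of \<open>M x* \<sigma>\<close>, and telescopes.
\<close>

section \<open>Subgradients of convex SPB functions\<close>

text \<open>The strict epigraph is convex and misses \<open>(x, f x)\<close>. A hyperplane
  separating the two cannot be vertical because \<open>f\<close> is finite everywhere, so its slope
  is a subgradient.\<close>

lemma convex_subgradient_exists:
  fixes f :: "'a::euclidean_space \<Rightarrow> real"
  assumes "convex_on UNIV f"
  shows "\<exists>\<zeta>. \<forall>y. f x + \<zeta> \<bullet> (y - x) \<le> f y"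
proof -
  let ?S = "{(y, r). f y < r}"
  have "convex ?S"
    unfolding convex_def
  proof (clarsimp)
    fix y r y' r' and u v :: real
    assume h: "f y < r" "f y' < r'" "0 \<le> u" "0 \<le> v" "u + v = 1"
    have "f (u *\<^sub>R y + v *\<^sub>R y') \<le> u * f y + v * f y'"
      using assms h unfolding convex_on_def by auto
    also have "\<dots> < u * r + v * r'"
    proof (cases "u = 0")
      case False
      then have "u * f y < u * r" using h by simp
      moreover have "v * f y' \<le> v * r'" using h by (intro mult_left_mono) auto
      ultimately show ?thesis by linarith
    qed (use h in auto)
    finally show "f (u *\<^sub>R y + v *\<^sub>R y') < u * r + v * r'" .
  qed
  moreover have "(x, f x + 1) \<in> ?S" by simp
  ultimately obtain a b where ab: "a \<noteq> 0" "\<forall>w\<in>?S. a \<bullet> w \<le> b" "\<forall>w\<in>{(x, f x)}. a \<bullet> w \<ge> b"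
    using separating_hyperplane_sets[of ?S "{(x, f x)}"] by fastforce
  obtain p q where a: "a = (p, q)" by fastforce
  have sep: "p \<bullet> y + q * r \<le> p \<bullet> x + q * f x" if "f y < r" for y r
    using ab(2,3) that unfolding a by (force simp: inner_Pair)
  have "q \<le> 0"
    using sep[of x "f x + 1"] by (simp add: algebra_simps)
  \<comment> \<open>With a vertical hyperplane, moving from \<open>x\<close> in the direction
    \<open>p\<close> would force \<open>p = 0\<close>, contradicting
    \<open>a \<noteq> 0\<close>.\<close>
  moreover have "q \<noteq> 0"
  proof
    assume "q = 0"
    then have "p \<bullet> (x + p) \<le> p \<bullet> x"
      using sep[of "x + p" "f (x + p) + 1"] by simp
    then have "p \<bullet> p \<le> 0" by (simp add: inner_add_right)
    then have "p = 0" by (metis inner_gt_zero_iff not_less)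
    with \<open>q = 0\<close> ab(1) a show False by (simp add: zero_prod_def)
  qed
  ultimately have q: "q < 0" by simp
  have "f x + (p /\<^sub>R (- q)) \<bullet> (y - x) \<le> f y" for y
  \<comment> \<open>Separation is available only strictly above the graph, so \<open>r\<close> is
    let down to \<open>f y\<close>.\<close>
  proof (rule dense_ge)
    fix r assume "f y < r"
    with sep[of y r] q show "f x + (p /\<^sub>R (- q)) \<bullet> (y - x) \<le> r"
      by (simp add: inner_diff_right field_simps)
  qed
  then show ?thesis by blast
qed

text \<open>The upper limit runs over base points and step lengths together. Testing it at the base
  point \<open>x\<close> itself with small steps suffices, since there the difference quotient
  dominates \<open>\<zeta> \<bullet> v\<close>.\<close>

lemma subgradient_in_clarke_subdiff:
  fixes f :: "'a::real_inner \<Rightarrow> real"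
  assumes "\<And>y. f x + \<zeta> \<bullet> (y - x) \<le> f y"
  shows "\<zeta> \<in> clarke_subdiff f x"
  unfolding clarke_subdiff_def clarke_dir_deriv_def Limsup_def
proof (intro CollectI allI INF_greatest, clarsimp)
  fix v and P :: "'a \<times> real \<Rightarrow> bool"
  assume "eventually P (at (x, 0) within UNIV \<times> {0<..})"
  then obtain e where e: "e > 0"
    "\<And>w. w \<in> UNIV \<times> {0<..} \<Longrightarrow> w \<noteq> (x, 0) \<Longrightarrow> dist w (x, 0) < e \<Longrightarrow> P w"
    unfolding eventually_at by blast
  have "P (x, e / 2)"
    using e by (intro e(2)) (auto simp: dist_Pair_Pair)
  moreover have "\<zeta> \<bullet> v \<le> (f (x + (e / 2) *\<^sub>R v) - f x) / (e / 2)"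
    using assms[of "x + (e / 2) *\<^sub>R v"] e(1) by (simp add: field_simps)
  ultimately show "ereal (\<zeta> \<bullet> v) \<le> Sup ((\<lambda>(y, t). ereal ((f (y + t *\<^sub>R v) - f y) / t)) ` Collect P)"
    by (intro SUP_upper2[of "(x, e / 2)"]) auto
qed

text \<open>Convexity takes the place of a mean value theorem: each signed difference is bounded
  through a subgradient at the point whose value enters positively.\<close>

lemma convex_SPB_increment_le:
  fixes f :: "'a::euclidean_space \<Rightarrow> real"
  assumes f: "convex_on UNIV f" and S: "SPB f R1 R2 m"
  shows "\<bar>f y - f x\<bar> \<le> (R1 * max (norm x) (norm y) ^ m + R2) * norm (y - x)"
proof -
  have R: "R1 \<ge> 0" using S by (simp add: SPB_def)
  have bound: "f w - f w' \<le> (R1 * max (norm x) (norm y) ^ m + R2) * norm (w - w')"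
    if "w = x \<or> w = y" for w w'
  proof -
    obtain \<zeta> where z: "\<And>y. f w + \<zeta> \<bullet> (y - w) \<le> f y"
      using convex_subgradient_exists[OF f] by blast
    have "norm \<zeta> \<le> R1 * norm w ^ m + R2"
      using S subgradient_in_clarke_subdiff[OF z] by (auto simp: SPB_def)
    also have "\<dots> \<le> R1 * max (norm x) (norm y) ^ m + R2"
      using that R by (intro add_right_mono mult_left_mono power_mono) auto
    finally have n: "norm \<zeta> \<le> R1 * max (norm x) (norm y) ^ m + R2" .
    have "f w - f w' \<le> \<zeta> \<bullet> (w - w')"
      using z[of w'] by (simp add: inner_diff_right)
    also have "\<dots> \<le> norm \<zeta> * norm (w - w')" by (rule norm_cauchy_schwarz)
    also have "\<dots> \<le> (R1 * max (norm x) (norm y) ^ m + R2) * norm (w - w')"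
      using n by (rule mult_right_mono) simp
    finally show ?thesis .
  qed
  show ?thesis
    using bound[of x y] bound[of y x] by (simp add: abs_le_iff norm_minus_commute)
qed

lemma SPB_imp_continuous_on:
  fixes f :: "'a::euclidean_space \<Rightarrow> real"
  assumes "SPB f R1 R2 m"
  shows "continuous_on UNIV f"
proof -
  have "isCont f x" for x
  proof -
    obtain e L where "e > 0" "L-lipschitz_on (ball x e) f"
      using assms unfolding SPB_def locally_lipschitz_def by blast
    then show ?thesis
      using lipschitz_on_continuous_on[of L "ball x e" f]
      by (auto simp: continuous_on_eq_continuous_at)
  qed
  then show ?thesis by (simp add: continuous_at_imp_continuous_on)
qed

text \<open>Convexity of the power function at the midpoint of \<open>a\<close> and
  \<open>b\<close>.\<close>

lemma power_add_le_two_powr: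
  fixes a b :: real
  assumes "0 \<le> a" "0 \<le> b" "m > 0"
  shows "(a + b) ^ m \<le> 2 powr (real m - 1) * (a ^ m + b ^ m)"
proof -
  have "convex_on {0..} (\<lambda>x::real. x ^ m)"
    using convex_power_even[of m] convex_power_odd[of m] by (cases "even m") (auto intro: convex_on_subset)
  then have "((1 - 1/2) *\<^sub>R a + (1/2) *\<^sub>R b) ^ m \<le> (1 - 1/2) * a ^ m + (1/2) * b ^ m"
    by (rule convex_onD) (use assms in auto)
  then have "((a + b) / 2) ^ m \<le> (a ^ m + b ^ m) / 2" by (simp add: add_divide_distrib)
  then have "(a + b) ^ m \<le> (2 ^ m / 2) * (a ^ m + b ^ m)"
    by (simp add: power_divide field_simps)
  then show ?thesis by (simp add: powr_diff powr_realpow)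
qed

text \<open>The basic growth estimate. It separates the dependence on \<open>x\<close> from that on
  \<open>u\<close>, so that later integrals over \<open>u\<close> reduce to Gaussian
  moments.\<close>

lemma SPB_increment_along_le:
  fixes f :: "'a::euclidean_space \<Rightarrow> real"
  assumes f: "convex_on UNIV f" and S: "SPB f R1 R2 m" and "\<sigma> > 0"
  defines "c \<equiv> 2 powr (real m - 1) * R1"
  shows "\<bar>f (x + \<sigma> *\<^sub>R u) - f x\<bar> \<le> (c * norm x ^ m + R2 + c * \<sigma> ^ m * norm u ^ m) * (\<sigma> * norm u)"
proof -
  have R: "R1 \<ge> 0" "m = 0 \<longleftrightarrow> R1 = 0" using S by (auto simp: SPB_def)
  have "R1 * max (norm x) (norm (x + \<sigma> *\<^sub>R u)) ^ m \<le> c * (norm x ^ m + (\<sigma> * norm u) ^ m)"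
  \<comment> \<open>If \<open>m = 0\<close>, the SPB convention forces \<open>R1 = 0\<close> and
    both sides vanish; otherwise the power of the sum is split.\<close>
  proof (cases "m = 0")
    case False
    have "max (norm x) (norm (x + \<sigma> *\<^sub>R u)) \<le> norm x + \<sigma> * norm u"
      using norm_triangle_ineq[of x "\<sigma> *\<^sub>R u"] \<open>\<sigma> > 0\<close> by simp
    then have "max (norm x) (norm (x + \<sigma> *\<^sub>R u)) ^ m \<le> (norm x + \<sigma> * norm u) ^ m"
      by (rule power_mono) (simp add: le_max_iff_disj)
    also have "\<dots> \<le> 2 powr (real m - 1) * (norm x ^ m + (\<sigma> * norm u) ^ m)"
      using False \<open>\<sigma> > 0\<close> by (intro power_add_le_two_powr) auto
    finally show ?thesis
      unfolding c_def using mult_left_mono[OF _ R(1)] by (fastforce simp: mult_ac)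
  qed (use R in \<open>simp add: c_def\<close>)
  then have "(R1 * max (norm x) (norm (x + \<sigma> *\<^sub>R u)) ^ m + R2) * (\<sigma> * norm u)
     \<le> (c * norm x ^ m + R2 + c * \<sigma> ^ m * norm u ^ m) * (\<sigma> * norm u)"
    using \<open>\<sigma> > 0\<close> by (intro mult_right_mono) (auto simp: algebra_simps power_mult_distrib)
  moreover have "\<bar>f (x + \<sigma> *\<^sub>R u) - f x\<bar>
      \<le> (R1 * max (norm x) (norm (x + \<sigma> *\<^sub>R u)) ^ m + R2) * (\<sigma> * norm u)"
    using convex_SPB_increment_le[OF f S, of "x + \<sigma> *\<^sub>R u" x] \<open>\<sigma> > 0\<close> by simp
  ultimately show ?thesis by (rule order_trans[rotated])
qed

section \<open>The standard Gaussian measure\<close>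

definition gauss_density :: "real^'d \<Rightarrow> real" where
  "gauss_density x = (2 * pi) powr (- real CARD('d) / 2) * exp (- (norm x)\<^sup>2 / 2)"

lemma std_gauss_eq_density: "std_gauss = density lborel (\<lambda>x. ennreal (gauss_density x))"
  by (simp add: std_gauss_def gauss_density_def)

lemma gauss_density_measurable [measurable]: "gauss_density \<in> borel_measurable borel"
  unfolding gauss_density_def by measurable

lemma gauss_density_pos [simp]: "0 < gauss_density x" "0 \<le> gauss_density x"
  by (simp_all add: gauss_density_def)

lemma sets_std_gauss [simp, measurable_cong]: "sets std_gauss = sets borel"
  by (simp add: std_gauss_def)

lemma space_std_gauss [simp]: "space std_gauss = UNIV"
  by (simp add: std_gauss_def)

text \<open>The density is a product of one-dimensional normal densities over the coordinates, so
  the total mass is a product of ones.\<close>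

lemma prob_space_std_gauss: "prob_space (std_gauss :: (real^'d) measure)"
proof
  have eq: "gauss_density (x :: real^'d) = (\<Prod>b\<in>Basis. std_normal_density (x \<bullet> b))" for x
  proof -
    have "(\<Prod>b\<in>Basis. std_normal_density (x \<bullet> b))
      = (1 / sqrt (2 * pi)) ^ CARD('d) * exp (\<Sum>b\<in>Basis. - (x \<bullet> b)\<^sup>2 / 2)"
      by (simp add: std_normal_density_def prod_dividef exp_sum power_divide)
    also have "(1 / sqrt (2 * pi)) ^ CARD('d) = (2 * pi) powr (- real CARD('d) / 2)"
      by (simp add: powr_half_sqrt[symmetric] powr_minus_divide powr_realpow[symmetric] powr_powr powr_divide)
    also have "(\<Sum>b\<in>Basis. - (x \<bullet> b)\<^sup>2 / 2) = - (norm x)\<^sup>2 / 2"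
      unfolding power2_norm_eq_inner euclidean_inner[of x x]
      by (simp add: sum_divide_distrib sum_negf power2_eq_square)
    finally show ?thesis by (simp add: gauss_density_def)
  qed
  have 1: "(\<integral>\<^sup>+x. ennreal (std_normal_density x) \<partial>lborel) = 1"
    using prob_space.emeasure_space_1[OF prob_space_normal_density[of 1 0]]
    by (simp add: emeasure_density)
  have "emeasure (std_gauss :: (real^'d) measure) (space std_gauss)
      = (\<integral>\<^sup>+x. ennreal (\<Prod>b\<in>Basis. std_normal_density (x \<bullet> b)) \<partial>(lborel :: (real^'d) measure))"
    unfolding std_gauss_eq_density by (simp add: emeasure_density eq)
  also have "\<dots> = (\<integral>\<^sup>+x. (\<Prod>b\<in>Basis. ennreal (std_normal_density (x \<bullet> b))) \<partial>(lborel :: (real^'d) measure))"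
    by (simp add: prod_ennreal)
  also have "\<dots> = (\<Prod>b\<in>(Basis :: (real^'d) set). \<integral>\<^sup>+x. ennreal (std_normal_density x) \<partial>lborel)"
    by (rule nn_integral_lborel_prod) auto
  also have "\<dots> = 1" by (simp add: 1)
  finally show "emeasure (std_gauss :: (real^'d) measure) (space std_gauss) = 1" .
qed

interpretation std_gauss: prob_space std_gauss
  by (rule prob_space_std_gauss)

lemma measure_std_gauss_UNIV [simp]: "measure std_gauss UNIV = 1"
  using std_gauss.prob_space by simp

section \<open>Integrability under the Gaussian measure\<close>

lemma integrable_std_gauss_iff:
  fixes g :: "real^'d \<Rightarrow> real"
  assumes [measurable]: "g \<in> borel_measurable borel"
  shows "integrable std_gauss g \<longleftrightarrow> integrable lborel (\<lambda>x. gauss_density x * g x)"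
  unfolding std_gauss_eq_density by (subst integrable_density) auto

lemma integral_std_gauss:
  fixes g :: "real^'d \<Rightarrow> real"
  assumes [measurable]: "g \<in> borel_measurable borel"
  shows "integral\<^sup>L std_gauss g = (\<integral>x. gauss_density x * g x \<partial>lborel)"
  unfolding std_gauss_eq_density by (subst integral_density) auto

text \<open>Used twice: to integrate a widened Gaussian density that serves as dominating function,
  and in the scaling argument behind the moment recursion.\<close>

lemma has_bochner_integral_lborel_scaleR:
  fixes g :: "'a::euclidean_space \<Rightarrow> real"
  assumes c: "c > 0" and g: "integrable lborel g"
  shows "has_bochner_integral lborel (\<lambda>x. g (c *\<^sub>R x)) ((1 / c) ^ DIM('a) * integral\<^sup>L lborel g)"
proof -
  have [measurable]: "g \<in> borel_measurable borel" using g by auto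
  have L: "lborel = density (distr lborel borel (\<lambda>x::'a. c *\<^sub>R x)) (\<lambda>_. ennreal (c ^ DIM('a)))"
    using lborel_affine[of c 0] c by simp
  have i: "integrable (density (distr lborel borel (\<lambda>x::'a. c *\<^sub>R x)) (\<lambda>_. ennreal (c ^ DIM('a)))) g"
    using g by (subst L[symmetric])
  have "integrable lborel (\<lambda>x. g (c *\<^sub>R x))"
    using i c by (subst (asm) integrable_density) (auto simp: integrable_distr_eq)
  moreover have "integral\<^sup>L lborel g = c ^ DIM('a) * (\<integral>x. g (c *\<^sub>R x) \<partial>lborel)"
    using c by (subst L, subst integral_density) (auto simp: integral_distr)
  ultimately show ?thesis
    using c by (simp add: has_bochner_integral_iff power_divide)
qed

lemma has_bochner_integral_le:
  fixes f g :: "'a \<Rightarrow> real"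
  assumes "has_bochner_integral M f a" "has_bochner_integral M g b" "\<And>x. f x \<le> g x"
  shows "a \<le> b"
  using assms integral_mono[of M f g] by (simp add: has_bochner_integral_iff)

lemma integrable_gauss_density: "integrable lborel (gauss_density :: real^'d \<Rightarrow> real)"
  using integrable_std_gauss_iff[of "\<lambda>_::real^'d. 1"] by simp

text \<open>Completing the square trades the factor \<open>exp (c * norm u)\<close> for the constant
  \<open>exp (c\<^sup>2)\<close> and a Gaussian wider by the factor \<open>sqrt 2\<close>.\<close>

lemma integrable_std_gauss_exp: "integrable std_gauss (\<lambda>u::real^'d. exp (c * norm u))"
proof -
  have "integrable lborel (\<lambda>u::real^'d. exp (c\<^sup>2) * gauss_density ((1 / sqrt 2) *\<^sub>R u))"
    using has_bochner_integral_lborel_scaleR[OF _ integrable_gauss_density, where 'd1='d and c="1 / sqrt 2"]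
    by (simp add: has_bochner_integral_iff)
  then have "integrable lborel (\<lambda>u::real^'d. gauss_density u * exp (c * norm u))"
  proof (rule Bochner_Integration.integrable_bound)
    show "AE u in lborel. norm (gauss_density u * exp (c * norm u))
      \<le> norm (exp (c\<^sup>2) * gauss_density ((1 / sqrt 2) *\<^sub>R (u::real^'d)))"
    proof (rule AE_I2)
      fix u :: "real^'d"
      have "0 \<le> (c - norm u / 2)\<^sup>2" by simp
      then have "- (norm u)\<^sup>2 / 2 + c * norm u \<le> c\<^sup>2 - (norm u)\<^sup>2 / 4"
        by (simp add: power2_eq_square algebra_simps)
      then have "exp (- (norm u)\<^sup>2 / 2) * exp (c * norm u) \<le> exp (c\<^sup>2) * exp (- (norm u)\<^sup>2 / 4)"
        by (simp add: exp_add[symmetric])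
      then show "norm (gauss_density u * exp (c * norm u))
          \<le> norm (exp (c\<^sup>2) * gauss_density ((1 / sqrt 2) *\<^sub>R u))"
        by (simp add: gauss_density_def abs_mult power_divide mult_ac)
    qed
  qed simp
  then show ?thesis by (subst integrable_std_gauss_iff) auto
qed

text \<open>Exponential growth is a suitable class because the tilts produced by shifting the
  Gaussian stay inside it.\<close>

lemma integrable_std_gauss_expI:
  fixes g :: "real^'d \<Rightarrow> real"
  assumes "g \<in> borel_measurable borel" "\<And>u. \<bar>g u\<bar> \<le> C * exp (c * norm u)"
  shows "integrable std_gauss g"
proof (rule Bochner_Integration.integrable_bound[OF integrable_mult_right[OF integrable_std_gauss_exp, of C c]])
  show "AE u in std_gauss. norm (g u) \<le> norm (C * exp (c * norm u))"
    using assms(2) by (intro AE_I2) (smt (verit) real_norm_def)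
qed (use assms in measurable)

lemma power_le_exp_mult:
  fixes r :: real assumes "0 \<le> r" shows "r ^ k \<le> exp (real k * r)"
proof -
  have "r ^ k \<le> exp r ^ k"
    using assms exp_ge_add_one_self[of r] by (intro power_mono) linarith+
  then show ?thesis by (simp add: exp_of_nat_mult)
qed

lemma integrable_std_gauss_norm_power: "integrable std_gauss (\<lambda>u::real^'d. norm u ^ k)"
  by (rule integrable_std_gauss_expI[of _ 1 "real k"]) (auto intro: power_le_exp_mult)

section \<open>Moments of the Gaussian norm\<close>

text \<open>The upper half of the exact recursion for the even moments; the explicit moment bounds
  below descend from it.\<close>

lemma std_gauss_even_moment_Suc_le:
  "(\<integral>u. norm u ^ (2 * Suc p) \<partial>(std_gauss :: (real^'d) measure))
    \<le> (real CARD('d) + 2 * real p) * (\<integral>u. norm u ^ (2 * p) \<partial>(std_gauss :: (real^'d) measure))"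
proof -
  define J where "J p = (\<integral>u. norm u ^ (2 * p) \<partial>(std_gauss :: (real^'d) measure))" for p
  \<comment> \<open>\<open>N\<close> counts the powers of \<open>s\<close>: the Jacobian contributes
    the dimension, the rescaled norm contributes \<open>2 * p\<close>.\<close>
  define N where "N = CARD('d) + 2 * p"
  have J0: "J p \<ge> 0" unfolding J_def by (intro Bochner_Integration.integral_nonneg) simp
  have J: "has_bochner_integral lborel (\<lambda>x::real^'d. gauss_density x * norm x ^ (2 * p)) (J p)" for p
    using integrable_std_gauss_norm_power[of "2 * p", where 'd='d]
    by (simp add: has_bochner_integral_iff J_def integral_std_gauss integrable_std_gauss_iff)
  have step: "J (Suc p) * ((1 + s) * s ^ N) \<le> 2 * real N * J p" if s: "0 < s" "s < 1" for s
  proof -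
    txt \<open>Rescaling \<open>x\<close> by \<open>s < 1\<close> and using \<open>1 + a \<le> exp a\<close> replaces integration by parts as \<open>s\<close> tends to \<open>1\<close>.\<close>
    have pt: "gauss_density x * norm x ^ (2 * p)
        + ((1 - s\<^sup>2) / 2) * (gauss_density x * norm x ^ (2 * Suc p))
        \<le> (1 / s) ^ (2 * p) * (gauss_density (s *\<^sub>R x) * norm (s *\<^sub>R x) ^ (2 * p))" for x :: "real^'d"
    proof -
      have "exp (- (norm x)\<^sup>2 / 2) * (1 + (1 - s\<^sup>2) * (norm x)\<^sup>2 / 2)
          \<le> exp (- (norm x)\<^sup>2 / 2) * exp ((1 - s\<^sup>2) * (norm x)\<^sup>2 / 2)"
        by (intro mult_left_mono exp_ge_add_one_self) auto
      also have "\<dots> = exp (- (s * norm x)\<^sup>2 / 2)"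
        by (simp add: exp_add[symmetric] field_simps power_mult_distrib)
      finally have "gauss_density x * (1 + (1 - s\<^sup>2) * (norm x)\<^sup>2 / 2) \<le> gauss_density (s *\<^sub>R x)"
        using s by (simp add: gauss_density_def mult.assoc)
      then have "gauss_density x * (1 + (1 - s\<^sup>2) * (norm x)\<^sup>2 / 2) * norm x ^ (2 * p)
          \<le> gauss_density (s *\<^sub>R x) * norm x ^ (2 * p)"
        by (rule mult_right_mono) simp
      also have "\<dots> = (1 / s) ^ (2 * p) * (gauss_density (s *\<^sub>R x) * norm (s *\<^sub>R x) ^ (2 * p))"
        using s by (simp add: power_mult_distrib power_divide)
      finally show ?thesis
        by (simp add: distrib_left distrib_right power2_eq_square mult_ac)
    qed
    have "J p + ((1 - s\<^sup>2) / 2) * J (Suc p) \<le> (1 / s) ^ (2 * p) * ((1 / s) ^ CARD('d) * J p)"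
    proof (rule has_bochner_integral_le)
      show "has_bochner_integral lborel (\<lambda>x::real^'d. gauss_density x * norm x ^ (2 * p)
        + ((1 - s\<^sup>2) / 2) * (gauss_density x * norm x ^ (2 * Suc p))) (J p + ((1 - s\<^sup>2) / 2) * J (Suc p))"
        by (intro has_bochner_integral_add has_bochner_integral_mult_right J)
      show "has_bochner_integral lborel (\<lambda>x::real^'d. (1 / s) ^ (2 * p) *
          (gauss_density (s *\<^sub>R x) * norm (s *\<^sub>R x) ^ (2 * p))) ((1 / s) ^ (2 * p) * ((1 / s) ^ CARD('d) * J p))"
        using has_bochner_integral_lborel_scaleR[OF s(1), of "\<lambda>x::real^'d. gauss_density x * norm x ^ (2 * p)"] J[of p]
        by (intro has_bochner_integral_mult_right) (simp add: has_bochner_integral_iff)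
    qed (rule pt)
    also have "\<dots> = J p / s ^ N"
      by (simp add: N_def power_add power_divide)
    finally have "(J p + ((1 - s\<^sup>2) / 2) * J (Suc p)) * s ^ N \<le> J p"
      using s by (simp add: pos_le_divide_eq)
    then have "(1 - s) * (J (Suc p) * ((1 + s) * s ^ N)) \<le> 2 * (1 - s ^ N) * J p"
      by (simp add: field_simps power2_eq_square)
    also have "\<dots> \<le> 2 * (real N * (1 - s)) * J p"
    proof -
      \<comment> \<open>Bernoulli's inequality produces a factor \<open>1 - s\<close> on the right
        as well, which cancels before the limit is taken.\<close>
      have "1 + real N * (s - 1) \<le> (1 + (s - 1)) ^ N"
        using s by (intro Bernoulli_inequality) auto
      then have "1 - s ^ N \<le> real N * (1 - s)" by (simp add: algebra_simps)
      then show ?thesis using J0 by (intro mult_right_mono mult_left_mono) auto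
    qed
    also have "\<dots> = (1 - s) * (2 * real N * J p)" by simp
    finally show ?thesis using s by simp
  qed
  have "((\<lambda>s. J (Suc p) * ((1 + s) * s ^ N)) \<longlongrightarrow> J (Suc p) * ((1 + 1) * 1 ^ N)) (at_left (1::real))"
    by (intro tendsto_intros)
  moreover have "eventually (\<lambda>s. J (Suc p) * ((1 + s) * s ^ N) \<le> 2 * real N * J p) (at_left (1::real))"
    by (rule eventually_mono[OF eventually_at_left_real[of 0 1]]) (use step in auto)
  ultimately have "J (Suc p) * ((1 + 1) * 1 ^ N) \<le> 2 * real N * J p"
    by (rule tendsto_upperbound) simp
  then have "J (Suc p) \<le> real N * J p" by simp
  then show ?thesis by (simp add: J_def N_def)
qed

lemma std_gauss_even_moment_le_prod:
  "(\<integral>u. norm u ^ (2 * p) \<partial>(std_gauss :: (real^'d) measure)) \<le> (\<Prod>i<p. real CARD('d) + 2 * real i)"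
proof (induction p)
  case 0
  then show ?case by simp
next
  case (Suc p)
  have "(\<integral>u. norm u ^ (2 * Suc p) \<partial>(std_gauss :: (real^'d) measure))
      \<le> (real CARD('d) + 2 * real p) * (\<Prod>i<p. real CARD('d) + 2 * real i)"
    by (rule order_trans[OF std_gauss_even_moment_Suc_le mult_left_mono[OF Suc]]) simp
  then show ?case by (simp add: mult.commute)
qed

text \<open>Every factor of the product is enlarged to the same value. The cases
  \<open>p = 2\<close> and \<open>p = m + 2\<close> supply the constants of
  \<open>H\<close>.\<close>

lemma std_gauss_even_moment_le:
  "(\<integral>u. norm u ^ (2 * p) \<partial>(std_gauss :: (real^'d) measure)) \<le> (real CARD('d) + 2 * real p) ^ p"
proof -
  have "(\<Prod>i<p. real CARD('d) + 2 * real i) \<le> (\<Prod>i<p. real CARD('d) + 2 * real p)"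
    by (intro prod_mono) auto
  with std_gauss_even_moment_le_prod[of p, where 'd='d] show ?thesis by simp
qed

text \<open>Nonnegativity of the variance of \<open>norm u ^ p\<close>.\<close>

lemma std_gauss_moment_le_sqrt:
  "(\<integral>u. norm u ^ p \<partial>(std_gauss :: (real^'d) measure))
     \<le> sqrt (\<integral>u. norm u ^ (2 * p) \<partial>(std_gauss :: (real^'d) measure))"
proof (rule real_le_rsqrt)
  have sq: "(norm u ^ p)\<^sup>2 = norm u ^ (2 * p)" for u :: "real^'d"
    by (simp add: power_mult[symmetric] mult.commute)
  have "0 \<le> std_gauss.variance (\<lambda>u::real^'d. norm u ^ p)"
    by (intro Bochner_Integration.integral_nonneg) simp
  also have "\<dots> = (\<integral>u. norm u ^ (2 * p) \<partial>(std_gauss :: (real^'d) measure))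
       - (\<integral>u. norm u ^ p \<partial>(std_gauss :: (real^'d) measure))\<^sup>2"
    using integrable_std_gauss_norm_power[where 'd='d]
    by (subst std_gauss.variance_eq) (simp_all add: sq)
  finally show "(\<integral>u. norm u ^ p \<partial>(std_gauss :: (real^'d) measure))\<^sup>2
     \<le> (\<integral>u. norm u ^ (2 * p) \<partial>(std_gauss :: (real^'d) measure))" by simp
qed

text \<open>Bounding all factors by the largest would leave \<open>2 * p\<close> in the base; a
  symmetric estimate leaves only \<open>p\<close>. The case \<open>p = m + 1\<close> supplies the
  last constant of \<open>M\<close>.\<close>

lemma std_gauss_moment_le:
  "(\<integral>u. norm u ^ p \<partial>(std_gauss :: (real^'d) measure)) \<le> (real p + real CARD('d)) powr (real p / 2)"
proof -
  define a where "a i = real CARD('d) + 2 * real i" for i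
  let ?b = "real p + real CARD('d)"
  have a0: "a i \<ge> 0" for i by (simp add: a_def)
  txt \<open>Pairing the factors \<open>i\<close> and \<open>p - 1 - i\<close> bounds the product by a pure power (AM-GM).\<close>
  have "(\<Prod>i<p. a i)\<^sup>2 = (\<Prod>i<p. a i) * (\<Prod>i<p. a (p - Suc i))"
    by (simp add: prod.nat_diff_reindex power2_eq_square)
  also have "\<dots> = (\<Prod>i<p. a i * a (p - Suc i))" by (rule prod.distrib[symmetric])
  also have "\<dots> \<le> (\<Prod>i<p. ?b\<^sup>2)"
  proof (intro prod_mono conjI)
    fix i assume "i \<in> {..<p}"
    \<comment> \<open>The mean of a pair does not depend on \<open>i\<close>: it is the dimension
      plus \<open>p - 1\<close>.\<close>
    then have s: "(a i + a (p - Suc i)) / 2 \<le> ?b"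
      by (auto simp: a_def of_nat_diff field_simps)
    have "a i * a (p - Suc i) \<le> ((a i + a (p - Suc i)) / 2)\<^sup>2"
      using zero_le_power2[of "a i - a (p - Suc i)"] by (simp add: power2_eq_square field_simps)
    also have "\<dots> \<le> ?b\<^sup>2"
      using s a0[of i] a0[of "p - Suc i"] by (intro power_mono) auto
    finally show "a i * a (p - Suc i) \<le> ?b\<^sup>2" .
  qed (simp add: a0)
  also have "\<dots> = (?b ^ p)\<^sup>2" by (simp add: power_mult[symmetric] mult.commute)
  finally have "(\<Prod>i<p. a i) \<le> ?b ^ p" by (rule power2_le_imp_le) simp
  then have "(\<integral>u. norm u ^ (2 * p) \<partial>(std_gauss :: (real^'d) measure)) \<le> ?b ^ p"
    using std_gauss_even_moment_le_prod[of p, where 'd='d] by (simp add: a_def)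
  then have "(\<integral>u. norm u ^ p \<partial>(std_gauss :: (real^'d) measure)) \<le> sqrt (?b ^ p)"
    using std_gauss_moment_le_sqrt[of p, where 'd='d] by (meson order_trans real_sqrt_le_mono)
  also have "\<dots> = ?b powr (real p / 2)"
    using add_nonneg_pos[of "real p" "real CARD('d)"] by (simp add: powr_half_sqrt[symmetric] powr_realpow[symmetric] powr_powr)
  finally show ?thesis .
qed

lemma std_gauss_norm_le:
  "(\<integral>u. norm u \<partial>(std_gauss :: (real^'d) measure)) \<le> sqrt (real CARD('d))"
  using std_gauss_moment_le_sqrt[of 1, where 'd='d] std_gauss_even_moment_le_prod[of 1, where 'd='d]
  by (simp) (meson order_trans real_sqrt_le_mono)

section \<open>Shifts of the Gaussian and the gradient inequality\<close>

text \<open>The Cameron-Martin formula: the translation moves from \<open>g\<close> to a weight that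
  is smooth in \<open>h\<close>.\<close>

lemma integral_std_gauss_shift:
  fixes g :: "real^'d \<Rightarrow> real"
  assumes [measurable]: "g \<in> borel_measurable borel"
  shows "(\<integral>u. g (u + h) \<partial>std_gauss) = (\<integral>u. g u * exp (u \<bullet> h - (norm h)\<^sup>2 / 2) \<partial>std_gauss)"
proof -
  have dens: "gauss_density (u - h) = gauss_density u * exp (u \<bullet> h - (norm h)\<^sup>2 / 2)" for u :: "real^'d"
  proof -
    have "- (norm (u - h))\<^sup>2 / 2 = - (norm u)\<^sup>2 / 2 + (u \<bullet> h - (norm h)\<^sup>2 / 2)"
      by (simp add: power2_norm_eq_inner inner_diff_left inner_diff_right inner_commute field_simps)
    then show ?thesis unfolding gauss_density_def by (simp only: exp_add mult.assoc)
  qed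
  have "(\<integral>u. g (u + h) \<partial>std_gauss) = (\<integral>u. gauss_density u * g (u + h) \<partial>lborel)"
    by (rule integral_std_gauss) measurable
  also have "\<dots> = (\<integral>u. gauss_density ((h + u) - h) * g (h + u) \<partial>lborel)"
    by (simp add: add.commute)
  also have "\<dots> = (\<integral>u. gauss_density (u - h) * g u \<partial>distr lborel borel ((+) h))"
    by (subst integral_distr) auto
  also have "\<dots> = (\<integral>u. gauss_density u * (g u * exp (u \<bullet> h - (norm h)\<^sup>2 / 2)) \<partial>lborel)"
    by (simp add: lborel_distr_plus dens mult_ac)
  also have "\<dots> = (\<integral>u. g u * exp (u \<bullet> h - (norm h)\<^sup>2 / 2) \<partial>std_gauss)"
    by (rule integral_std_gauss[symmetric]) measurable
  finally show ?thesis .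
qed

text \<open>The factor \<open>\<bar>b\<bar>\<close> on the right is what later cancels a division by
  the step length.\<close>

lemma abs_exp_minus_one_le: "\<bar>exp b - 1\<bar> \<le> \<bar>b\<bar> * exp \<bar>b\<bar>" for b :: real
proof (cases "b \<ge> 0")
  case True
  have "exp b * (1 - b) \<le> exp b * exp (- b)"
    using exp_ge_add_one_self[of "- b"] by (intro mult_left_mono) auto
  then have "exp b - 1 \<le> b * exp b" by (simp add: exp_add[symmetric] algebra_simps)
  then show ?thesis using True by simp
next
  case False
  have "1 - exp b \<le> - b" using exp_ge_add_one_self[of b] by linarith
  also have "- b * 1 \<le> - b * exp (- b)" using False by (intro mult_left_mono) auto
  finally show ?thesis using False by simp
qed

text \<open>After shifting the Gaussian, the difference quotient of \<open>t \<mapsto> E F(u + t h)\<close> at \<open>0\<close>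
  is an integral that no longer differentiates \<open>F\<close>; convexity bounds it by its value at \<open>t = 1\<close>.\<close>

lemma std_gauss_convex_gradient_ineq:
  fixes F :: "real^'d \<Rightarrow> real"
  assumes F: "convex_on UNIV F" and meas [measurable]: "F \<in> borel_measurable borel"
    and growth: "\<And>u. \<bar>F u\<bar> \<le> C * exp (c * norm u)" and "c \<ge> 0"
  shows "(\<integral>u. F u * (u \<bullet> h) \<partial>std_gauss) \<le> (\<integral>u. F (u + h) \<partial>std_gauss) - (\<integral>u. F u \<partial>std_gauss)"
proof -
  have C: "C \<ge> 0" using growth[of 0] by simp
  have int: "integrable std_gauss (\<lambda>u. F (u + k))" for k
  proof (rule integrable_std_gauss_expI)
    fix u :: "real^'d"
    have "\<bar>F (u + k)\<bar> \<le> C * exp (c * norm (u + k))" by (rule growth)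
    also have "\<dots> \<le> C * exp (c * norm k + c * norm u)"
      using C \<open>c \<ge> 0\<close> norm_triangle_ineq[of u k]
      by (intro mult_left_mono) (auto simp: distrib_left[symmetric] intro!: mult_left_mono)
    finally show "\<bar>F (u + k)\<bar> \<le> (C * exp (c * norm k)) * exp (c * norm u)"
      by (simp add: exp_add mult_ac)
  qed measurable
  have int0: "integrable std_gauss F" using int[of 0] by simp
  \<comment> \<open>Step lengths tending to \<open>0\<close>. That they are at most \<open>1\<close>
    serves both convexity on the segment from \<open>u\<close> to \<open>u + h\<close> and
    domination uniform in \<open>n\<close>.\<close>
  define t where "t n = 1 / real (Suc n)" for n
  have t: "0 < t n" "t n \<le> 1" for n by (auto simp: t_def)
  have t0: "t \<longlonglongrightarrow> 0" unfolding t_def by (rule LIMSEQ_Suc[OF lim_1_over_n])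
  \<comment> \<open>A shift by \<open>t n *\<^sub>R h\<close> tilts the Gaussian by
    \<open>exp (b n u)\<close>. \<open>G n\<close> is the resulting difference quotient, with the
    increment carried by the weight and not by \<open>F\<close>.\<close>
  define q where "q = (norm h)\<^sup>2 / 2"
  define b where "b n u = t n * (u \<bullet> h) - (t n)\<^sup>2 * q" for n u
  define G where "G n u = F u * ((exp (b n u) - 1) / t n)" for n u
  define A where "A u = norm h * norm u + q" for u :: "real^'d"
  have "q \<ge> 0" by (simp add: q_def)
  have A: "A u \<ge> 0" for u using \<open>q \<ge> 0\<close> by (simp add: A_def)
  have [measurable]: "G n \<in> borel_measurable borel" for n
    unfolding G_def b_def by measurable
  \<comment> \<open>A dominating function free of \<open>n\<close>: \<open>b n u\<close> is at most
    \<open>t n * A u\<close> in size, the factor \<open>t n\<close> cancels the quotient, and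
    \<open>A u\<close> is absorbed into an exponential.\<close>
  have Gbound: "\<bar>G n u\<bar> \<le> C * exp (2 * q) * exp ((c + 2 * norm h) * norm u)" for n u
  proof -
    have "\<bar>b n u\<bar> \<le> t n * \<bar>u \<bullet> h\<bar> + (t n)\<^sup>2 * q"
      unfolding b_def using t(1)[of n] \<open>q \<ge> 0\<close>
      by (intro order_trans[OF abs_triangle_ineq4]) (simp add: abs_mult)
    also have "\<dots> \<le> t n * (norm h * norm u) + t n * q"
      using t[of n] \<open>q \<ge> 0\<close> Cauchy_Schwarz_ineq2[of u h]
      by (intro add_mono mult_left_mono mult_right_mono) (auto simp: power2_eq_square mult.commute mult_left_le)
    finally have b: "\<bar>b n u\<bar> \<le> t n * A u" by (simp add: A_def algebra_simps)
    also have "\<dots> \<le> A u" using t[of n] A[of u] by (simp add: mult_left_le_one_le)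
    finally have b': "\<bar>b n u\<bar> \<le> A u" .
    have "\<bar>exp (b n u) - 1\<bar> \<le> (t n * A u) * exp (A u)"
      using b b' A[of u] t(1)[of n]
      by (intro order_trans[OF abs_exp_minus_one_le] mult_mono) auto
    then have "\<bar>(exp (b n u) - 1) / t n\<bar> \<le> A u * exp (A u)"
      using t(1)[of n] by (simp add: field_simps)
    also have "\<dots> \<le> exp (A u) * exp (A u)"
      using exp_ge_add_one_self[of "A u"] by (intro mult_right_mono) (linarith, simp)
    finally have "\<bar>(exp (b n u) - 1) / t n\<bar> \<le> exp (2 * A u)" by (simp add: exp_add[symmetric])
    then have "\<bar>G n u\<bar> \<le> (C * exp (c * norm u)) * exp (2 * A u)"
      unfolding G_def abs_mult using growth[of u] C by (intro mult_mono) auto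
    also have "\<dots> = C * exp (2 * q) * exp ((c + 2 * norm h) * norm u)"
      by (simp add: A_def exp_add[symmetric] algebra_simps)
    finally show ?thesis .
  qed
  have quot: "(\<integral>u. G n u \<partial>std_gauss) \<le> (\<integral>u. F (u + h) \<partial>std_gauss) - (\<integral>u. F u \<partial>std_gauss)" for n
  proof -
    have shift: "(\<integral>u. F (u + t n *\<^sub>R h) \<partial>std_gauss) = (\<integral>u. F u * exp (b n u) \<partial>std_gauss)"
      by (simp add: integral_std_gauss_shift b_def q_def power_mult_distrib)
    have iG: "integrable std_gauss (G n)"
      by (rule integrable_std_gauss_expI[OF _ Gbound]) measurable
    have "F u * exp (b n u) = F u + t n * G n u" for u
      using t(1)[of n] by (simp add: G_def field_simps)
    then have e1: "(\<integral>u. F (u + t n *\<^sub>R h) \<partial>std_gauss)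
        = (\<integral>u. F u \<partial>std_gauss) + t n * (\<integral>u. G n u \<partial>std_gauss)"
      unfolding shift using iG int0 by simp
    have "(\<integral>u. F (u + t n *\<^sub>R h) \<partial>std_gauss)
        \<le> (\<integral>u. (1 - t n) * F u + t n * F (u + h) \<partial>std_gauss)"
    proof (rule integral_mono[OF int])
      show "integrable std_gauss (\<lambda>u. (1 - t n) * F u + t n * F (u + h))"
        using int0 int by simp
      fix u
      \<comment> \<open>The shifted point lies on the segment from \<open>u\<close> to
        \<open>u + h\<close>, so the quotient is at most the full increment.\<close>
      have "F ((1 - t n) *\<^sub>R u + t n *\<^sub>R (u + h)) \<le> (1 - t n) * F u + t n * F (u + h)"
        using t[of n] by (intro convex_onD[OF F]) auto
      then show "F (u + t n *\<^sub>R h) \<le> (1 - t n) * F u + t n * F (u + h)"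
        by (simp add: algebra_simps)
    qed
    also have "\<dots> = (1 - t n) * (\<integral>u. F u \<partial>std_gauss) + t n * (\<integral>u. F (u + h) \<partial>std_gauss)"
      using int0 int by simp
    finally have "t n * (\<integral>u. G n u \<partial>std_gauss)
       \<le> t n * ((\<integral>u. F (u + h) \<partial>std_gauss) - (\<integral>u. F u \<partial>std_gauss))"
      unfolding e1 by (simp add: algebra_simps)
    then show ?thesis using t(1)[of n] by simp
  qed
  have "(\<lambda>n. \<integral>u. G n u \<partial>std_gauss) \<longlonglongrightarrow> (\<integral>u. F u * (u \<bullet> h) \<partial>std_gauss)"
  proof (rule integral_dominated_convergence)
    show "integrable std_gauss (\<lambda>u::real^'d. C * exp (2 * q) * exp ((c + 2 * norm h) * norm u))"
      by (intro integrable_mult_right integrable_std_gauss_exp)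
    show "AE u in std_gauss. (\<lambda>n. G n u) \<longlonglongrightarrow> F u * (u \<bullet> h)"
    proof (rule AE_I2)
      fix u
      have "((\<lambda>s. exp (s * (u \<bullet> h) - s\<^sup>2 * q)) has_real_derivative (u \<bullet> h)) (at 0)"
        by (auto intro!: derivative_eq_intros)
      then have "((\<lambda>s. (exp (s * (u \<bullet> h) - s\<^sup>2 * q) - 1) / s) \<longlongrightarrow> u \<bullet> h) (at 0)"
        by (simp add: has_field_derivative_iff)
      moreover have "filterlim t (at 0) sequentially"
        unfolding filterlim_at using t0 t(1) by (auto simp: less_imp_neq[symmetric])
      ultimately have "(\<lambda>n. (exp (b n u) - 1) / t n) \<longlonglongrightarrow> u \<bullet> h"
        unfolding b_def by (rule filterlim_compose)
      then show "(\<lambda>n. G n u) \<longlonglongrightarrow> F u * (u \<bullet> h)"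
        unfolding G_def by (intro tendsto_intros)
    qed
    show "AE u in std_gauss. norm (G n u) \<le> C * exp (2 * q) * exp ((c + 2 * norm h) * norm u)" for n
      using Gbound by simp
  qed measurable
  then show ?thesis by (rule LIMSEQ_le_const2) (use quot in blast)
qed

text \<open>For the constant function \<open>1\<close> the gradient inequality has right side
  \<open>0\<close>; applying it to \<open>h\<close> and to \<open>- h\<close> gives
  equality.\<close>

lemma integral_std_gauss_inner: "(\<integral>u. u \<bullet> h \<partial>(std_gauss :: (real^'d) measure)) = 0"
proof -
  have "(\<integral>u. u \<bullet> k \<partial>(std_gauss :: (real^'d) measure)) \<le> 0" for k
    using std_gauss_convex_gradient_ineq[of "\<lambda>_::real^'d. 1" 1 0 k] by (simp add: convex_on_const)
  from this[of h] this[of "- h"] show ?thesis by simp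
qed

lemma integrable_std_gauss_inner: "integrable (std_gauss :: (real^'d) measure) (\<lambda>u. u \<bullet> h)"
proof (rule integrable_std_gauss_expI[of _ "norm h" 1])
  fix u :: "real^'d"
  have "norm u * norm h \<le> exp (norm u) * norm h"
    using exp_ge_add_one_self[of "norm u"] by (intro mult_right_mono) (linarith, simp)
  then show "\<bar>u \<bullet> h\<bar> \<le> norm h * exp (1 * norm u)"
    using Cauchy_Schwarz_ineq2[of u h] by (simp add: mult.commute)
qed measurable

section \<open>Smoothing and the gradient estimator\<close>

locale smoothed_convex_SPB =
  fixes f :: "real^'d \<Rightarrow> real" and R1 R2 \<sigma> :: real and m :: nat
  assumes convex: "convex_on UNIV f" and SPB: "SPB f R1 R2 m" and \<sigma>_pos: "\<sigma> > 0"
begin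

text \<open>The exponent is real because \<open>m = 0\<close> makes it negative; in that case
  \<open>R1 = 0\<close> and so \<open>c = 0\<close>.\<close>

definition "c = 2 powr (real m - 1) * R1"

definition v :: "real^'d \<Rightarrow> real^'d \<Rightarrow> real^'d" where
  "v x u = ((f (x + \<sigma> *\<^sub>R u) - f x) / \<sigma>) *\<^sub>R u"

definition M :: "real^'d \<Rightarrow> real" where
  "M y = (c * norm y ^ m + R2) * sqrt (real CARD('d))
     + c * \<sigma> ^ m * (real m + 1 + real CARD('d)) powr ((real m + 1) / 2)"

definition H :: real where
  "H = 3 * max (c\<^sup>2 * (4 + real CARD('d))\<^sup>2)
     (R2\<^sup>2 * (4 + real CARD('d))\<^sup>2 + c\<^sup>2 * \<sigma> ^ (2 * m) * (2 * real m + 4 + real CARD('d)) ^ (m + 2))"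

lemma R1_nonneg: "R1 \<ge> 0" and R2_pos: "R2 > 0" and c_nonneg: "c \<ge> 0"
  using SPB by (auto simp: SPB_def c_def)

lemma M_nonneg: "M y \<ge> 0"
  using c_nonneg R2_pos \<sigma>_pos by (simp add: M_def)

lemma f_measurable [measurable]: "f \<in> borel_measurable borel"
  using SPB_imp_continuous_on[OF SPB] by (rule borel_measurable_continuous_onI)

lemma v_measurable [measurable]:
  "(\<lambda>(x, u). v x u) \<in> borel_measurable (borel \<Otimes>\<^sub>M borel)"
  unfolding v_def by measurable

lemma increment_le:
  "\<bar>f (x + \<sigma> *\<^sub>R u) - f x\<bar> \<le> (c * norm x ^ m + R2 + c * \<sigma> ^ m * norm u ^ m) * (\<sigma> * norm u)"
  unfolding c_def by (rule SPB_increment_along_le[OF convex SPB \<sigma>_pos])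

text \<open>Puts the polynomial growth into the exponential form required by the integrability test
  and by the gradient inequality.\<close>

lemma growth:
  "\<bar>f (x + \<sigma> *\<^sub>R u)\<bar>
     \<le> (\<bar>f x\<bar> + (c * norm x ^ m + R2) * \<sigma> + c * \<sigma> ^ m * \<sigma>) * exp (real (Suc m) * norm u)"
proof -
  let ?e = "exp (real (Suc m) * norm u)"
  have r: "norm u ^ Suc m \<le> ?e" by (rule power_le_exp_mult) simp
  have 1: "1 \<le> ?e" by simp
  have "norm u ^ 1 \<le> exp (real 1 * norm u)" by (rule power_le_exp_mult) simp
  also have "\<dots> \<le> ?e" by (simp add: algebra_simps)
  finally have r1: "norm u \<le> ?e" by simp
  have "\<bar>f (x + \<sigma> *\<^sub>R u)\<bar> \<le> \<bar>f x\<bar> + \<bar>f (x + \<sigma> *\<^sub>R u) - f x\<bar>" by linarith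
  also have "\<dots> \<le> \<bar>f x\<bar> * 1 + ((c * norm x ^ m + R2) * \<sigma>) * norm u + (c * \<sigma> ^ m * \<sigma>) * norm u ^ Suc m"
    using increment_le[of x u] by (simp add: algebra_simps)
  also have "\<dots> \<le> \<bar>f x\<bar> * ?e + ((c * norm x ^ m + R2) * \<sigma>) * ?e + (c * \<sigma> ^ m * \<sigma>) * ?e"
    using r 1 r1 c_nonneg R2_pos \<sigma>_pos by (intro add_mono mult_left_mono) auto
  finally show ?thesis by (simp add: distrib_right)
qed

lemma integrable_smooth: "integrable std_gauss (\<lambda>u. f (x + \<sigma> *\<^sub>R u))"
  by (rule integrable_std_gauss_expI[OF _ growth]) measurable

section \<open>Comparison of a function with its smoothing\<close>

text \<open>Jensen's inequality through an affine minorant at \<open>x\<close>, whose linear part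
  has Gaussian mean zero.\<close>

lemma gauss_smooth_ge: "f x \<le> gauss_smooth f \<sigma> x"
proof -
  obtain \<zeta> where z: "\<And>y. f x + \<zeta> \<bullet> (y - x) \<le> f y"
    using convex_subgradient_exists[OF convex] by blast
  have "f x = (\<integral>u. f x + \<sigma> * (u \<bullet> \<zeta>) \<partial>(std_gauss :: (real^'d) measure))"
    using integrable_std_gauss_inner[of \<zeta>]
    by (simp add: integral_std_gauss_inner)
  also have "\<dots> \<le> gauss_smooth f \<sigma> x"
    unfolding gauss_smooth_def
  proof (rule integral_mono)
    show "integrable std_gauss (\<lambda>u::real^'d. f x + \<sigma> * (u \<bullet> \<zeta>))"
      using integrable_std_gauss_inner[of \<zeta>] by simp
    show "f x + \<sigma> * (u \<bullet> \<zeta>) \<le> f (x + \<sigma> *\<^sub>R u)" for u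
      using z[of "x + \<sigma> *\<^sub>R u"] by (simp add: inner_commute)
  qed (rule integrable_smooth)
  finally show ?thesis .
qed

text \<open>Integrating the growth estimate leaves the moments of order \<open>1\<close> and
  \<open>m + 1\<close>, which become the two summands of \<open>M\<close>.\<close>

lemma gauss_smooth_le: "gauss_smooth f \<sigma> x \<le> f x + M x * \<sigma>"
proof -
  let ?a = "c * norm x ^ m + R2" and ?b = "c * \<sigma> ^ m"
  have i1: "integrable std_gauss (\<lambda>u::real^'d. norm u)"
    using integrable_std_gauss_norm_power[of 1, where 'd='d] by simp
  note i2 = integrable_std_gauss_norm_power[of "Suc m", where 'd='d]
  have "gauss_smooth f \<sigma> x \<le> (\<integral>u. f x + \<sigma> * (?a * norm u + ?b * norm u ^ Suc m) \<partial>(std_gauss :: (real^'d) measure))"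
    unfolding gauss_smooth_def
  proof (rule integral_mono[OF integrable_smooth])
    show "integrable std_gauss (\<lambda>u::real^'d. f x + \<sigma> * (?a * norm u + ?b * norm u ^ Suc m))"
      using i1 i2 by simp
    show "f (x + \<sigma> *\<^sub>R u) \<le> f x + \<sigma> * (?a * norm u + ?b * norm u ^ Suc m)" for u
      using increment_le[of x u] by (simp add: algebra_simps)
  qed
  also have "\<dots> = f x + \<sigma> * (?a * (\<integral>u. norm u \<partial>(std_gauss :: (real^'d) measure))
       + ?b * (\<integral>u. norm u ^ Suc m \<partial>(std_gauss :: (real^'d) measure)))"
    using i1 i2 by (simp del: power_Suc)
  also have "\<dots> \<le> f x + \<sigma> * (?a * sqrt (real CARD('d))
       + ?b * (real (Suc m) + real CARD('d)) powr (real (Suc m) / 2))"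
    using std_gauss_norm_le[where 'd='d] std_gauss_moment_le[of "Suc m", where 'd='d] c_nonneg R2_pos \<sigma>_pos
    by (intro add_left_mono mult_left_mono add_mono) auto
  also have "\<dots> = f x + M x * \<sigma>"
    by (simp add: M_def algebra_simps)
  finally show ?thesis .
qed

section \<open>Second moment and mean of the estimator\<close>

lemma norm_v_sq_le:
  "(norm (v x u))\<^sup>2 \<le> 3 * (((c * norm x ^ m)\<^sup>2 + R2\<^sup>2) * norm u ^ (2 * 2)
      + c\<^sup>2 * \<sigma> ^ (2 * m) * norm u ^ (2 * (m + 2)))"
proof -
  have split: "norm u ^ (2 * (m + 2)) = norm u ^ (2 * m) * norm u ^ (2 * 2)"
    by (simp only: distrib_left power_add)
  define a where "a = c * norm x ^ m"
  define b where "b = c * \<sigma> ^ m * norm u ^ m"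
  have "\<bar>f (x + \<sigma> *\<^sub>R u) - f x\<bar> / \<sigma> \<le> (a + R2 + b) * norm u"
    using increment_le[of x u] \<sigma>_pos by (simp add: a_def b_def field_simps)
  then have "\<bar>f (x + \<sigma> *\<^sub>R u) - f x\<bar> / \<sigma> * norm u \<le> (a + R2 + b) * norm u * norm u"
    by (rule mult_right_mono) simp
  then have "norm (v x u) \<le> (a + R2 + b) * norm u * norm u"
    using \<sigma>_pos by (simp add: v_def)
  then have "(norm (v x u))\<^sup>2 \<le> ((a + R2 + b) * norm u * norm u)\<^sup>2"
    by (rule power_mono) simp
  also have "\<dots> = (a + R2 + b)\<^sup>2 * norm u ^ (2 * 2)"
    by (simp add: power_mult_distrib power_mult)
  also have "\<dots> \<le> (3 * (a\<^sup>2 + R2\<^sup>2 + b\<^sup>2)) * norm u ^ (2 * 2)"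
  proof (rule mult_right_mono)
    \<comment> \<open>The pairwise differences bound the cross terms of the square; this is the
      origin of the factor \<open>3\<close> in \<open>H\<close>.\<close>
    have "0 \<le> (a - R2)\<^sup>2 + (a - b)\<^sup>2 + (R2 - b)\<^sup>2" by simp
    then show "(a + R2 + b)\<^sup>2 \<le> 3 * (a\<^sup>2 + R2\<^sup>2 + b\<^sup>2)"
      by (simp add: power2_eq_square algebra_simps)
  qed simp
  also have "b\<^sup>2 = c\<^sup>2 * \<sigma> ^ (2 * m) * norm u ^ (2 * m)"
    by (simp add: b_def power_mult_distrib power_mult[symmetric] mult.commute)
  finally have "(norm (v x u))\<^sup>2 \<le> 3 * (a\<^sup>2 + R2\<^sup>2 + c\<^sup>2 * \<sigma> ^ (2 * m) * norm u ^ (2 * m)) * norm u ^ (2 * 2)" .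
  then show ?thesis
    unfolding a_def split by (simp only: distrib_left distrib_right mult_ac add_ac)
qed

lemma integrable_norm_v_sq: "integrable std_gauss (\<lambda>u. (norm (v x u))\<^sup>2)"
proof (rule Bochner_Integration.integrable_bound)
  show "integrable std_gauss (\<lambda>u::real^'d. 3 * (((c * norm x ^ m)\<^sup>2 + R2\<^sup>2) * norm u ^ (2 * 2)
      + c\<^sup>2 * \<sigma> ^ (2 * m) * norm u ^ (2 * (m + 2))))"
    by (intro integrable_mult_right Bochner_Integration.integrable_add integrable_std_gauss_norm_power)
  show "AE u in std_gauss. norm ((norm (v x u))\<^sup>2)
     \<le> norm (3 * (((c * norm x ^ m)\<^sup>2 + R2\<^sup>2) * norm u ^ (2 * 2)
      + c\<^sup>2 * \<sigma> ^ (2 * m) * norm u ^ (2 * (m + 2))))"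
    using norm_v_sq_le[of x] by (intro AE_I2) (smt (verit) real_norm_def zero_le_power2)
qed measurable

lemma second_moment_v_le: "(\<integral>u. (norm (v x u))\<^sup>2 \<partial>std_gauss) \<le> H * (norm x ^ m + 1)\<^sup>2"
proof -
  let ?D = "real CARD('d)"
  let ?A = "c\<^sup>2 * (4 + ?D)\<^sup>2" and ?B = "R2\<^sup>2 * (4 + ?D)\<^sup>2 + c\<^sup>2 * \<sigma> ^ (2 * m) * (2 * real m + 4 + ?D) ^ (m + 2)"
  note i = integrable_std_gauss_norm_power[where 'd='d]
  have "(\<integral>u. (norm (v x u))\<^sup>2 \<partial>std_gauss)
     \<le> (\<integral>u. 3 * (((c * norm x ^ m)\<^sup>2 + R2\<^sup>2) * norm u ^ (2 * 2)
      + c\<^sup>2 * \<sigma> ^ (2 * m) * norm u ^ (2 * (m + 2))) \<partial>(std_gauss :: (real^'d) measure))"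
    by (intro integral_mono integrable_norm_v_sq norm_v_sq_le integrable_mult_right
        Bochner_Integration.integrable_add i)
  also have "\<dots> = 3 * (((c * norm x ^ m)\<^sup>2 + R2\<^sup>2) * (\<integral>u. norm u ^ (2 * 2) \<partial>(std_gauss :: (real^'d) measure))
      + c\<^sup>2 * \<sigma> ^ (2 * m) * (\<integral>u. norm u ^ (2 * (m + 2)) \<partial>(std_gauss :: (real^'d) measure)))"
    by (subst integral_mult_right_zero, subst Bochner_Integration.integral_add)
       (simp_all only: integral_mult_right_zero integrable_mult_right i)
  also have "\<dots> \<le> 3 * (((c * norm x ^ m)\<^sup>2 + R2\<^sup>2) * (?D + 2 * real 2) ^ 2
      + c\<^sup>2 * \<sigma> ^ (2 * m) * (?D + 2 * real (m + 2)) ^ (m + 2))"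
    using \<sigma>_pos
    by (intro mult_left_mono add_mono std_gauss_even_moment_le) auto
  also have "\<dots> = 3 * (?A * (norm x ^ m)\<^sup>2 + ?B)"
    by (simp add: power_mult_distrib algebra_simps)
  \<comment> \<open>The maximum makes the two coefficients equal, so that \<open>H\<close>
    multiplies a single expression in \<open>norm x ^ m\<close>.\<close>
  also have "\<dots> \<le> 3 * (max ?A ?B * (norm x ^ m)\<^sup>2 + max ?A ?B)"
    by (intro mult_left_mono add_mono mult_right_mono) auto
  also have "\<dots> = H * ((norm x ^ m)\<^sup>2 + 1)"
    by (simp add: H_def algebra_simps)
  also have "\<dots> \<le> H * (norm x ^ m + 1)\<^sup>2"
  proof (rule mult_left_mono)
    show "H \<ge> 0" by (simp add: H_def le_max_iff_disj)
  qed (simp add: power2_eq_square algebra_simps)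
  finally show ?thesis .
qed

lemma integrable_v_inner: "integrable std_gauss (\<lambda>u. v x u \<bullet> w)"
proof (rule Bochner_Integration.integrable_bound)
  show "integrable std_gauss (\<lambda>u. (norm (v x u))\<^sup>2 + (norm w)\<^sup>2)"
    using integrable_norm_v_sq by simp
  have "\<bar>v x u \<bullet> w\<bar> \<le> (norm (v x u))\<^sup>2 + (norm w)\<^sup>2" for u
  proof -
    have "norm (v x u) * norm w \<le> (norm (v x u))\<^sup>2 + (norm w)\<^sup>2"
      using sum_squares_bound[of "norm (v x u)" "norm w"] mult_nonneg_nonneg[of "norm (v x u)" "norm w"]
      unfolding mult.assoc by (smt (verit) norm_ge_zero)
    then show ?thesis using Cauchy_Schwarz_ineq2[of "v x u" w] by linarith
  qed
  then show "AE u in std_gauss. norm (v x u \<bullet> w) \<le> norm ((norm (v x u))\<^sup>2 + (norm w)\<^sup>2)"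
    by (intro AE_I2) (smt (verit) real_norm_def)
qed measurable

text \<open>The mean of \<open>v x\<close> acts as a subgradient of the smoothing at
  \<open>x\<close>. The term \<open>f x\<close> in \<open>v\<close> does not change the mean since
  the Gaussian is centred; the gradient inequality then applies with the \<open>h\<close> that
  carries \<open>x\<close> to \<open>z\<close>.\<close>

lemma v_inner_le: "(\<integral>u. v x u \<bullet> (z - x) \<partial>std_gauss) \<le> gauss_smooth f \<sigma> z - gauss_smooth f \<sigma> x"
proof -
  define F where "F u = f (x + \<sigma> *\<^sub>R u)" for u
  define h where "h = (z - x) /\<^sub>R \<sigma>"
  have F: "convex_on UNIV F"
  proof (rule convex_onI)
    fix t :: real and u w assume t: "0 < t" "t < 1"
    have "x + \<sigma> *\<^sub>R ((1 - t) *\<^sub>R u + t *\<^sub>R w) = (1 - t) *\<^sub>R (x + \<sigma> *\<^sub>R u) + t *\<^sub>R (x + \<sigma> *\<^sub>R w)"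
      by (simp add: algebra_simps)
    then show "F ((1 - t) *\<^sub>R u + t *\<^sub>R w) \<le> (1 - t) * F u + t * F w"
      unfolding F_def using convex_onD[OF convex, of t "x + \<sigma> *\<^sub>R u" "x + \<sigma> *\<^sub>R w"] t by simp
  qed simp
  have vh: "v x u \<bullet> (z - x) = F u * (u \<bullet> h) - f x * (u \<bullet> h)" for u
    by (simp add: v_def F_def h_def divide_inverse algebra_simps)
  have iF: "integrable std_gauss (\<lambda>u. F u * (u \<bullet> h))"
    using Bochner_Integration.integrable_add[OF integrable_v_inner[of x "z - x"]
        integrable_mult_right[OF integrable_std_gauss_inner[of h], of "f x"]]
    by (simp add: vh)
  have "(\<integral>u. v x u \<bullet> (z - x) \<partial>std_gauss) = (\<integral>u. F u * (u \<bullet> h) \<partial>std_gauss)"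
    unfolding vh using iF integrable_std_gauss_inner[of h]
    by (simp add: integral_std_gauss_inner)
  also have "\<dots> \<le> (\<integral>u. F (u + h) \<partial>std_gauss) - (\<integral>u. F u \<partial>std_gauss)"
  proof (rule std_gauss_convex_gradient_ineq[OF F])
    show "F \<in> borel_measurable borel" unfolding F_def by measurable
    show "\<bar>F u\<bar> \<le> (\<bar>f x\<bar> + (c * norm x ^ m + R2) * \<sigma> + c * \<sigma> ^ m * \<sigma>) * exp (real (Suc m) * norm u)" for u
      unfolding F_def by (rule growth)
  qed simp
  also have "(\<lambda>u. F (u + h)) = (\<lambda>u. f (z + \<sigma> *\<^sub>R u))"
    using \<sigma>_pos by (auto simp: F_def h_def algebra_simps)
  finally show ?thesis by (simp add: gauss_smooth_def F_def)
qed

section \<open>One projected step\<close>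

text \<open>The point \<open>z\<close> is fixed by the projection, so nonexpansiveness reduces the
  claim to expanding a square; the cross term is controlled by the mean of \<open>v x\<close>, the
  last term by its second moment.\<close>

lemma projected_step_le:
  fixes x :: "real^'d"
  assumes \<Omega>: "closed \<Omega>" "convex \<Omega>" and z: "z \<in> \<Omega>" and "\<tau> > 0"
  defines "P \<equiv> \<lambda>u. closest_point \<Omega> (x - (\<tau> / (norm x ^ m + 1)) *\<^sub>R v x u)"
  shows "integrable std_gauss (\<lambda>u. (norm (P u - z))\<^sup>2)" (is ?I)
    and "(\<integral>u. (norm (P u - z))\<^sup>2 \<partial>std_gauss)
      \<le> (norm (x - z))\<^sup>2 + \<tau> * (2 / (norm x ^ m + 1) * (gauss_smooth f \<sigma> z - gauss_smooth f \<sigma> x)) + H * \<tau>\<^sup>2"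
proof -
  define t where "t = \<tau> / (norm x ^ m + 1)"
  have pos: "norm x ^ m + 1 > 0" by (simp add: add_nonneg_pos)
  then have t: "t > 0" using \<open>\<tau> > 0\<close> by (simp add: t_def)
  have [measurable]: "closest_point \<Omega> \<in> borel_measurable borel"
    using z by (intro borel_measurable_continuous_onI continuous_on_closest_point \<Omega>) auto
  have pt: "(norm (P u - z))\<^sup>2 \<le> (norm (x - z))\<^sup>2 + (2 * t) * (v x u \<bullet> (z - x)) + t\<^sup>2 * (norm (v x u))\<^sup>2" for u
  proof -
    have "dist (closest_point \<Omega> (x - t *\<^sub>R v x u)) (closest_point \<Omega> z) \<le> dist (x - t *\<^sub>R v x u) z"
      using z by (intro closest_point_lipschitz \<Omega>) auto
    then have "norm (P u - z) \<le> norm ((x - z) - t *\<^sub>R v x u)"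
      using z by (simp add: P_def t_def closest_point_self dist_norm algebra_simps)
    then have "(norm (P u - z))\<^sup>2 \<le> (norm ((x - z) - t *\<^sub>R v x u))\<^sup>2" by (rule power_mono) simp
    also have "\<dots> = (norm (x - z))\<^sup>2 + (2 * t) * (v x u \<bullet> (z - x)) + t\<^sup>2 * (norm (v x u))\<^sup>2"
      unfolding power2_norm_eq_inner by (simp add: inner_diff_left inner_diff_right inner_commute
          power2_eq_square algebra_simps)
    finally show ?thesis .
  qed
  have i: "integrable std_gauss (\<lambda>u. (norm (x - z))\<^sup>2 + (2 * t) * (v x u \<bullet> (z - x)) + t\<^sup>2 * (norm (v x u))\<^sup>2)"
    by (intro Bochner_Integration.integrable_add integrable_mult_right integrable_v_inner integrable_norm_v_sq) simp
  show ?I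
  proof (rule Bochner_Integration.integrable_bound[OF i])
    show "(\<lambda>u. (norm (P u - z))\<^sup>2) \<in> borel_measurable std_gauss"
      unfolding P_def by measurable
    show "AE u in std_gauss. norm ((norm (P u - z))\<^sup>2)
       \<le> norm ((norm (x - z))\<^sup>2 + (2 * t) * (v x u \<bullet> (z - x)) + t\<^sup>2 * (norm (v x u))\<^sup>2)"
      using pt by (intro AE_I2) (smt (verit) real_norm_def zero_le_power2)
  qed
  from this i have "(\<integral>u. (norm (P u - z))\<^sup>2 \<partial>std_gauss)
     \<le> (\<integral>u. (norm (x - z))\<^sup>2 + (2 * t) * (v x u \<bullet> (z - x)) + t\<^sup>2 * (norm (v x u))\<^sup>2 \<partial>std_gauss)"
    by (rule integral_mono) (rule pt)
  also have "\<dots> = (norm (x - z))\<^sup>2 + (2 * t) * (\<integral>u. v x u \<bullet> (z - x) \<partial>std_gauss)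
       + t\<^sup>2 * (\<integral>u. (norm (v x u))\<^sup>2 \<partial>std_gauss)"
    by (simp add: integrable_v_inner integrable_norm_v_sq)
  also have "\<dots> \<le> (norm (x - z))\<^sup>2 + (2 * t) * (gauss_smooth f \<sigma> z - gauss_smooth f \<sigma> x)
       + t\<^sup>2 * (H * (norm x ^ m + 1)\<^sup>2)"
    using t by (intro add_mono mult_left_mono v_inner_le second_moment_v_le) auto
  \<comment> \<open>The normalization of the step exactly cancels the growth of the second moment,
    so this term is free of \<open>x\<close>.\<close>
  also have "t\<^sup>2 * (H * (norm x ^ m + 1)\<^sup>2) = H * \<tau>\<^sup>2"
    using pos by (simp add: t_def power_divide)
  finally show "(\<integral>u. (norm (P u - z))\<^sup>2 \<partial>std_gauss)
      \<le> (norm (x - z))\<^sup>2 + \<tau> * (2 / (norm x ^ m + 1) * (gauss_smooth f \<sigma> z - gauss_smooth f \<sigma> x)) + H * \<tau>\<^sup>2"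
    by (simp add: t_def mult_ac)
qed

end

section \<open>The projected iteration\<close>

lemma gauss_seq_component_measurable [measurable]:
  "(\<lambda>\<omega>. \<omega> i) \<in> measurable gauss_seq (borel :: (real^'d) measure)" for i :: nat
proof -
  have "(\<lambda>\<omega>. \<omega> i) \<in> measurable gauss_seq (std_gauss :: (real^'d) measure)"
    unfolding gauss_seq_def by (rule measurable_component_singleton) simp
  also have "measurable gauss_seq (std_gauss :: (real^'d) measure) = measurable gauss_seq borel"
    by (rule measurable_cong_sets) simp_all
  finally show ?thesis .
qed

text \<open>Splicing two independent sequences at position \<open>k\<close> preserves the law,
  leaves \<open>y\<close> unchanged and makes coordinate \<open>k\<close> independent of it, so
  Fubini applies. Nonnegative integrals allow integrability of the iterates to be derived from
  this.\<close>

lemma nn_integral_gauss_seq_fresh: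
  fixes g :: "(real^'d) \<times> (real^'d) \<Rightarrow> ennreal"
  assumes [measurable]: "g \<in> borel_measurable (borel \<Otimes>\<^sub>M borel)" "y \<in> borel_measurable gauss_seq"
    and past: "\<forall>\<omega> \<omega>'. (\<forall>i<k. \<omega> i = \<omega>' i) \<longrightarrow> y \<omega> = y \<omega>'"
  shows "(\<integral>\<^sup>+\<omega>. g (y \<omega>, \<omega> k) \<partial>gauss_seq) = (\<integral>\<^sup>+\<omega>. \<integral>\<^sup>+u. g (y \<omega>, u) \<partial>std_gauss \<partial>gauss_seq)"
proof -
  interpret sequence_space "std_gauss :: (real^'d) measure" ..
  have S: "S = gauss_seq" by (simp add: gauss_seq_def)
  have [measurable]: "y \<in> borel_measurable S" by (simp add: S)
  have [measurable]: "(\<lambda>\<omega>. \<omega> i) \<in> measurable S borel" for i :: nat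
    unfolding S by (rule gauss_seq_component_measurable)
  have fresh: "(\<integral>\<^sup>+u. g (a, u) \<partial>std_gauss) = (\<integral>\<^sup>+\<omega>'. g (a, \<omega>' 0) \<partial>S)" for a
  proof -
    have "g \<circ> Pair a \<in> borel_measurable borel"
      by (rule measurable_comp[OF measurable_Pair1' assms(1)]) simp
    then have g_meas: "(\<lambda>u. g (a, u)) \<in> borel_measurable std_gauss"
      by (simp add: comp_def std_gauss_def)
    have "std_gauss = distr S std_gauss (\<lambda>\<omega>'. \<omega>' (0::nat))"
      by (rule PiM_component[symmetric]) simp
    then have "(\<integral>\<^sup>+u. g (a, u) \<partial>std_gauss) = (\<integral>\<^sup>+u. g (a, u) \<partial>distr S std_gauss (\<lambda>\<omega>'. \<omega>' (0::nat)))"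
      by simp
    also have "\<dots> = (\<integral>\<^sup>+\<omega>'. g (a, \<omega>' 0) \<partial>S)"
      using g_meas by (subst nn_integral_distr[OF measurable_component_singleton[OF UNIV_I]]) simp_all
    finally show ?thesis .
  qed
  \<comment> \<open>\<open>comb_seq k\<close> keeps the first \<open>k\<close> entries of
    \<open>\<omega>\<close> and restarts with index \<open>0\<close> of \<open>\<omega>'\<close>, so
    index \<open>k\<close> is already fresh.\<close>
  have comb: "y (comb_seq k \<omega> \<omega>') = y \<omega>" "comb_seq k \<omega> \<omega>' k = \<omega>' 0" for \<omega> \<omega>'
    using past[rule_format, of "comb_seq k \<omega> \<omega>'" \<omega>] by (auto simp: comb_seq_def)
  have "(\<integral>\<^sup>+\<omega>. g (y \<omega>, \<omega> k) \<partial>S)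
      = (\<integral>\<^sup>+\<omega>. g (y \<omega>, \<omega> k) \<partial>distr (S \<Otimes>\<^sub>M S) S (\<lambda>(\<omega>, \<omega>'). comb_seq k \<omega> \<omega>'))"
    by (simp add: PiM_comb_seq)
  also have "\<dots> = (\<integral>\<^sup>+p. g (y (fst p), snd p 0) \<partial>(S \<Otimes>\<^sub>M S))"
    by (subst nn_integral_distr) (auto simp: split_beta' comb)
  also have "\<dots> = (\<integral>\<^sup>+\<omega>. \<integral>\<^sup>+\<omega>'. g (y \<omega>, \<omega>' 0) \<partial>S \<partial>S)"
    by (subst P.nn_integral_fst[symmetric]) auto
  also have "\<dots> = (\<integral>\<^sup>+\<omega>. \<integral>\<^sup>+u. g (y \<omega>, u) \<partial>std_gauss \<partial>S)"
    by (simp only: fresh)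
  finally show ?thesis by (simp add: S)
qed

text \<open>The tower property as an inequality. Integrability is a conclusion here, which lets it
  propagate by induction over the iterations.\<close>

lemma integral_gauss_seq_fresh_le:
  fixes g :: "(real^'d) \<times> (real^'d) \<Rightarrow> real"
  assumes [measurable]: "g \<in> borel_measurable (borel \<Otimes>\<^sub>M borel)" "y \<in> borel_measurable gauss_seq"
    and past: "\<forall>\<omega> \<omega>'. (\<forall>i<k. \<omega> i = \<omega>' i) \<longrightarrow> y \<omega> = y \<omega>'"
    and nonneg: "\<And>p. 0 \<le> g p"
    and int: "\<And>\<omega>. integrable std_gauss (\<lambda>u. g (y \<omega>, u))"
    and le: "\<And>\<omega>. (\<integral>u. g (y \<omega>, u) \<partial>std_gauss) \<le> B \<omega>"
    and B: "integrable gauss_seq B"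
  shows "integrable gauss_seq (\<lambda>\<omega>. g (y \<omega>, \<omega> k))"
    and "(\<integral>\<omega>. g (y \<omega>, \<omega> k) \<partial>gauss_seq) \<le> (\<integral>\<omega>. B \<omega> \<partial>gauss_seq)"
proof -
  have B0: "B \<omega> \<ge> 0" for \<omega>
    by (rule order_trans[OF _ le]) (intro Bochner_Integration.integral_nonneg nonneg)
  have "(\<integral>\<^sup>+\<omega>. ennreal (g (y \<omega>, \<omega> k)) \<partial>gauss_seq)
      = (\<integral>\<^sup>+\<omega>. \<integral>\<^sup>+u. ennreal (g (y \<omega>, u)) \<partial>std_gauss \<partial>gauss_seq)"
    by (rule nn_integral_gauss_seq_fresh[where g="\<lambda>p. ennreal (g p)"]) (measurable, rule past)
  also have "\<dots> \<le> (\<integral>\<^sup>+\<omega>. ennreal (B \<omega>) \<partial>gauss_seq)"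
    using le by (intro nn_integral_mono) (simp add: nn_integral_eq_integral int nonneg ennreal_leI)
  also have "\<dots> = ennreal (\<integral>\<omega>. B \<omega> \<partial>gauss_seq)"
    using B B0 by (simp add: nn_integral_eq_integral)
  finally have *: "(\<integral>\<^sup>+\<omega>. ennreal (g (y \<omega>, \<omega> k)) \<partial>gauss_seq) \<le> ennreal (\<integral>\<omega>. B \<omega> \<partial>gauss_seq)" .
  show i: "integrable gauss_seq (\<lambda>\<omega>. g (y \<omega>, \<omega> k))"
    using le_less_trans[OF * ennreal_less_top] nonneg by (intro integrableI_nonneg) auto
  have "ennreal (\<integral>\<omega>. g (y \<omega>, \<omega> k) \<partial>gauss_seq) \<le> ennreal (\<integral>\<omega>. B \<omega> \<partial>gauss_seq)"
    using * by (simp add: nn_integral_eq_integral i nonneg)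
  then show "(\<integral>\<omega>. g (y \<omega>, \<omega> k) \<partial>gauss_seq) \<le> (\<integral>\<omega>. B \<omega> \<partial>gauss_seq)"
    using B0 by (simp add: ennreal_le_iff Bochner_Integration.integral_nonneg)
qed

interpretation gauss_seq: prob_space "gauss_seq :: (nat \<Rightarrow> real^'d) measure"
  unfolding gauss_seq_def by (rule prob_space_PiM) (rule prob_space_std_gauss)

section \<open>The recursion and its expected descent\<close>

locale zeroth_order_method = smoothed_convex_SPB f R1 R2 \<sigma> m
  for f :: "real^'d \<Rightarrow> real" and R1 R2 \<sigma> m +
  fixes \<Omega> :: "(real^'d) set" and x0 :: "real^'d" and \<tau> :: "nat \<Rightarrow> real"
    and x :: "nat \<Rightarrow> (nat \<Rightarrow> real^'d) \<Rightarrow> real^'d"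
  assumes closed: "closed \<Omega>" and cvx: "convex \<Omega>" and x0: "x0 \<in> \<Omega>"
    and \<tau>_pos: "\<And>k. \<tau> k > 0"
    and x_0: "\<And>\<omega>. x 0 \<omega> = x0"
    and x_Suc: "\<And>k \<omega>. x (Suc k) \<omega> = closest_point \<Omega>
       (x k \<omega> - (\<tau> k / (norm (x k \<omega>) ^ m + 1)) *\<^sub>R v (x k \<omega>) (\<omega> k))"
begin

lemma x_in: "x k \<omega> \<in> \<Omega>"
  using x0 by (cases k) (auto simp: x_0 x_Suc intro!: closest_point_in_set closed)

text \<open>The pathwise form of independence: the draw \<open>\<omega> k\<close> is first read when
  \<open>x (Suc k)\<close> is formed.\<close>

lemma x_past: "\<forall>\<omega> \<omega>'. (\<forall>i<k. \<omega> i = \<omega>' i) \<longrightarrow> x k \<omega> = x k \<omega>'"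
proof (induction k)
  case (Suc k)
  then show ?case by (simp add: x_Suc) (metis less_SucI lessI)
qed (simp add: x_0)

lemma closest_point_measurable [measurable]: "closest_point \<Omega> \<in> borel_measurable borel"
  using x0 by (intro borel_measurable_continuous_onI continuous_on_closest_point closed cvx) auto

lemma x_measurable [measurable]: "x k \<in> borel_measurable gauss_seq"
proof (induction k)
  case 0
  have "x 0 = (\<lambda>_. x0)" by (auto simp: x_0)
  then show ?case by simp
next
  case (Suc k)
  note [measurable] = Suc
  have "x (Suc k) = (\<lambda>\<omega>. closest_point \<Omega>
       (x k \<omega> - (\<tau> k / (norm (x k \<omega>) ^ m + 1)) *\<^sub>R v (x k \<omega>) (\<omega> k)))"
    by (auto simp: x_Suc)
  then show ?case by simp
qed

text \<open>The function \<open>b\<close> stands in for the normalized gap of the smoothing, so that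
  integrability is required of \<open>b\<close> only. Both claims are instances:
  \<open>b = 0\<close> for the first, a bound through the gap of \<open>f\<close> for the
  second.\<close>

lemma expected_step_le:
  fixes b :: "real^'d \<Rightarrow> real"
  assumes z: "z \<in> \<Omega>" and int: "integrable gauss_seq (\<lambda>\<omega>. (norm (x k \<omega> - z))\<^sup>2)"
    and b: "\<And>y. y \<in> \<Omega> \<Longrightarrow> 2 / (norm y ^ m + 1) * (gauss_smooth f \<sigma> z - gauss_smooth f \<sigma> y) \<le> b y"
    and int_b: "integrable gauss_seq (\<lambda>\<omega>. b (x k \<omega>))"
  shows "integrable gauss_seq (\<lambda>\<omega>. (norm (x (Suc k) \<omega> - z))\<^sup>2)"
    and "(\<integral>\<omega>. (norm (x (Suc k) \<omega> - z))\<^sup>2 \<partial>gauss_seq)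
      \<le> (\<integral>\<omega>. (norm (x k \<omega> - z))\<^sup>2 \<partial>gauss_seq) + \<tau> k * (\<integral>\<omega>. b (x k \<omega>) \<partial>gauss_seq) + H * (\<tau> k)\<^sup>2"
proof -
  define g where "g = (\<lambda>(y, u). (norm (closest_point \<Omega> (y - (\<tau> k / (norm y ^ m + 1)) *\<^sub>R v y u) - z))\<^sup>2)"
  define B where "B \<omega> = (norm (x k \<omega> - z))\<^sup>2 + \<tau> k * b (x k \<omega>) + H * (\<tau> k)\<^sup>2" for \<omega>
  have g_x: "g (x k \<omega>, \<omega> k) = (norm (x (Suc k) \<omega> - z))\<^sup>2" for \<omega>
    by (simp add: g_def x_Suc)
  have g_meas: "g \<in> borel_measurable (borel \<Otimes>\<^sub>M borel)"
    unfolding g_def by measurable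
  have g_int: "integrable std_gauss (\<lambda>u. g (x k \<omega>, u))" for \<omega>
    unfolding g_def using projected_step_le(1)[OF closed cvx z \<tau>_pos] by simp
  have g_le: "(\<integral>u. g (x k \<omega>, u) \<partial>std_gauss) \<le> B \<omega>" for \<omega>
  proof -
    have "(\<integral>u. g (x k \<omega>, u) \<partial>std_gauss) \<le> (norm (x k \<omega> - z))\<^sup>2 + \<tau> k * (2 / (norm (x k \<omega>) ^ m + 1) *
        (gauss_smooth f \<sigma> z - gauss_smooth f \<sigma> (x k \<omega>))) + H * (\<tau> k)\<^sup>2"
      unfolding g_def using projected_step_le(2)[OF closed cvx z \<tau>_pos, of "x k \<omega>" k] by simp
    also have "\<dots> \<le> B \<omega>"
      unfolding B_def using \<tau>_pos[of k]
      by (intro add_mono mult_left_mono b x_in order_refl) simp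
    finally show ?thesis .
  qed
  have B_int: "integrable gauss_seq B"
    unfolding B_def using int int_b by simp
  have nonneg: "0 \<le> g p" for p by (simp add: g_def split_beta')
  note * = integral_gauss_seq_fresh_le[OF g_meas x_measurable x_past nonneg g_int g_le B_int]
  show "integrable gauss_seq (\<lambda>\<omega>. (norm (x (Suc k) \<omega> - z))\<^sup>2)"
    using *(1) by (simp add: g_x)
  show "(\<integral>\<omega>. (norm (x (Suc k) \<omega> - z))\<^sup>2 \<partial>gauss_seq)
      \<le> (\<integral>\<omega>. (norm (x k \<omega> - z))\<^sup>2 \<partial>gauss_seq) + \<tau> k * (\<integral>\<omega>. b (x k \<omega>) \<partial>gauss_seq) + H * (\<tau> k)\<^sup>2"
    using *(2) int int_b by (simp add: g_x B_def gauss_seq.prob_space)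
qed

lemma smoothed_minimizer_descent:
  assumes z: "z \<in> \<Omega>" "\<forall>u\<in>\<Omega>. gauss_smooth f \<sigma> z \<le> gauss_smooth f \<sigma> u"
  shows "(\<integral>\<omega>. (norm (x (Suc k) \<omega> - z))\<^sup>2 \<partial>gauss_seq)
    \<le> (\<integral>\<omega>. (norm (x k \<omega> - z))\<^sup>2 \<partial>gauss_seq) + H * (\<tau> k)\<^sup>2"
proof -
  have b: "2 / (norm y ^ m + 1) * (gauss_smooth f \<sigma> z - gauss_smooth f \<sigma> y) \<le> 0" if "y \<in> \<Omega>" for y
    using z(2) that by (intro mult_nonneg_nonpos) auto
  \<comment> \<open>A Bochner integral has default value \<open>0\<close>, so the expected squared
    distances are first shown to be genuine.\<close>
  have int: "integrable gauss_seq (\<lambda>\<omega>. (norm (x k \<omega> - z))\<^sup>2)" for k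
  proof (induction k)
    case (Suc k)
    show ?case by (rule expected_step_le(1)[where b="\<lambda>_. 0", OF z(1) Suc b]) simp_all
  qed (simp add: x_0)
  show ?thesis
    using expected_step_le(2)[where b="\<lambda>_. 0", OF z(1) int b] by simp
qed

lemma expected_gap_descent:
  assumes xs: "xs \<in> \<Omega>"
  defines "r \<equiv> \<lambda>y. (f y - f xs) / (norm y ^ m + 1)"
  shows "2 * \<tau> k * ((\<integral>\<omega>. r (x k \<omega>) \<partial>gauss_seq) - M xs * \<sigma>)
    \<le> (\<integral>\<omega>. (norm (x k \<omega> - xs))\<^sup>2 \<partial>gauss_seq) - (\<integral>\<omega>. (norm (x (Suc k) \<omega> - xs))\<^sup>2 \<partial>gauss_seq) + H * (\<tau> k)\<^sup>2"
proof -
  \<comment> \<open>Obtained by bounding the smoothing above at \<open>xs\<close> and below at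
    \<open>y\<close>.\<close>
  define b where "b y = 2 * (M xs * \<sigma>) - 2 * r y" for y
  have pos: "norm y ^ m + 1 > 0" "norm y ^ m + 1 \<ge> 1" for y :: "real^'d" by (simp_all add: add_nonneg_pos)
  have b: "2 / (norm y ^ m + 1) * (gauss_smooth f \<sigma> xs - gauss_smooth f \<sigma> y) \<le> b y" for y
  proof -
    have "gauss_smooth f \<sigma> xs - gauss_smooth f \<sigma> y \<le> M xs * \<sigma> - (f y - f xs)"
      using gauss_smooth_le[of xs] gauss_smooth_ge[of y] by simp
    then have "2 / (norm y ^ m + 1) * (gauss_smooth f \<sigma> xs - gauss_smooth f \<sigma> y)
       \<le> 2 / (norm y ^ m + 1) * (M xs * \<sigma> - (f y - f xs))"
      using pos[of y] by (intro mult_left_mono) auto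
    also have "\<dots> = 2 * (M xs * \<sigma> / (norm y ^ m + 1)) - 2 * r y"
      by (simp add: r_def right_diff_distrib diff_divide_distrib)
    \<comment> \<open>The smoothing error is nonnegative and the denominator at least
      \<open>1\<close>, so the error may shed its weight.\<close>
    also have "M xs * \<sigma> / (norm y ^ m + 1) \<le> M xs * \<sigma> / 1"
      using pos(1)[of y] M_nonneg[of xs] \<sigma>_pos by (intro divide_left_mono pos(2)) (simp, simp only: mult_1_right)
    finally show ?thesis by (simp add: b_def)
  qed
  \<comment> \<open>The normalization leaves linear growth in the distance to \<open>xs\<close>, so
    the gap is integrable whenever the squared distance is.\<close>
  have r_bound: "\<bar>r y\<bar> \<le> (R1 + R1 * norm xs ^ m + R2) * (1 + (norm (y - xs))\<^sup>2)" for y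
  proof -
    let ?K = "R1 + R1 * norm xs ^ m + R2"
    have K: "?K \<ge> 0" using R1_nonneg R2_pos by simp
    have "max (norm xs) (norm y) ^ m \<le> norm xs ^ m + norm y ^ m"
      by (auto simp: max_def)
    then have "R1 * max (norm xs) (norm y) ^ m \<le> R1 * (norm xs ^ m + norm y ^ m)"
      using R1_nonneg by (rule mult_left_mono)
    moreover have "0 \<le> R1 * norm xs ^ m * norm y ^ m" "0 \<le> R2 * norm y ^ m"
      using R1_nonneg R2_pos by simp_all
    ultimately have "R1 * max (norm xs) (norm y) ^ m + R2 \<le> ?K * (norm y ^ m + 1)"
      using R1_nonneg by (simp only: distrib_left distrib_right mult_1_right mult_1_left)
    then have "\<bar>f y - f xs\<bar> \<le> ?K * (norm y ^ m + 1) * norm (y - xs)"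
      by (intro order_trans[OF convex_SPB_increment_le[OF convex SPB]] mult_right_mono) auto
    then have "\<bar>r y\<bar> \<le> ?K * norm (y - xs)"
      unfolding r_def abs_divide using pos(1)[of y] by (simp add: pos_divide_le_eq mult_ac)
    also have "\<dots> \<le> ?K * (1 + (norm (y - xs))\<^sup>2)"
    proof (rule mult_left_mono[OF _ K])
      show "norm (y - xs) \<le> 1 + (norm (y - xs))\<^sup>2"
        using sum_squares_bound[of 1 "norm (y - xs)"] norm_ge_zero[of "y - xs"]
        unfolding power_one mult_1_right by linarith
    qed
    finally show ?thesis .
  qed
  have [measurable]: "r \<in> borel_measurable borel" unfolding r_def by measurable
  have int_r: "integrable gauss_seq (\<lambda>\<omega>. r (x k \<omega>))"
    if "integrable gauss_seq (\<lambda>\<omega>. (norm (x k \<omega> - xs))\<^sup>2)" for k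
  proof (rule Bochner_Integration.integrable_bound)
    show "integrable gauss_seq (\<lambda>\<omega>. (R1 + R1 * norm xs ^ m + R2) * (1 + (norm (x k \<omega> - xs))\<^sup>2))"
      using that by simp
    show "AE \<omega> in gauss_seq. norm (r (x k \<omega>)) \<le> norm ((R1 + R1 * norm xs ^ m + R2) * (1 + (norm (x k \<omega> - xs))\<^sup>2))"
      using r_bound by (intro AE_I2) (smt (verit) real_norm_def)
  qed measurable
  \<comment> \<open>Integrability alternates: the squared distance at step \<open>k\<close> controls
    the gap there, which in turn permits step \<open>k + 1\<close>.\<close>
  have int: "integrable gauss_seq (\<lambda>\<omega>. (norm (x k \<omega> - xs))\<^sup>2)" for k
  proof (induction k)
    case (Suc k)
    show ?case by (rule expected_step_le(1)[OF xs Suc b]) (simp add: b_def int_r[OF Suc])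
  qed (simp add: x_0)
  have "integrable gauss_seq (\<lambda>\<omega>. b (x k \<omega>))" by (simp add: b_def int_r[OF int])
  from expected_step_le(2)[OF xs int b this] int_r[OF int, of k] show ?thesis
    by (simp add: b_def gauss_seq.prob_space algebra_simps)
qed

lemma min_expected_gap_le:
  assumes xs: "xs \<in> \<Omega>"
  shows "(MIN k\<in>{0..T}. \<integral>\<omega>. (f (x k \<omega>) - f xs) / (norm (x k \<omega>) ^ m + 1) \<partial>gauss_seq)
     \<le> 1 / (2 * (\<Sum>k=0..T. \<tau> k)) * ((norm (x0 - xs))\<^sup>2 + H * (\<Sum>k=0..T. (\<tau> k)\<^sup>2)) + M xs * \<sigma>"
proof -
  define e where "e k = (\<integral>\<omega>. (f (x k \<omega>) - f xs) / (norm (x k \<omega>) ^ m + 1) \<partial>gauss_seq)" for k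
  define D where "D k = (\<integral>\<omega>. (norm (x k \<omega> - xs))\<^sup>2 \<partial>gauss_seq)" for k
  let ?m = "MIN k\<in>{0..T}. e k" and ?S = "\<Sum>k=0..T. \<tau> k"
  have S: "?S > 0" using \<tau>_pos by (intro sum_pos) auto
  have "2 * ?S * (?m - M xs * \<sigma>) = (\<Sum>k=0..T. 2 * \<tau> k * (?m - M xs * \<sigma>))"
    by (simp add: sum_distrib_left sum_distrib_right)
  also have "\<dots> \<le> (\<Sum>k=0..T. D k - D (Suc k) + H * (\<tau> k)\<^sup>2)"
  proof (rule sum_mono)
    fix k assume "k \<in> {0..T}"
    \<comment> \<open>The minimum is below every term, hence also below each after weighting by the
      step size.\<close>
    then have "?m \<le> e k" by (intro Min_le) auto
    then have "2 * \<tau> k * (?m - M xs * \<sigma>) \<le> 2 * \<tau> k * (e k - M xs * \<sigma>)"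
      using \<tau>_pos[of k] by (intro mult_left_mono) auto
    also have "\<dots> \<le> D k - D (Suc k) + H * (\<tau> k)\<^sup>2"
      unfolding e_def D_def by (rule expected_gap_descent[OF xs])
    finally show "2 * \<tau> k * (?m - M xs * \<sigma>) \<le> D k - D (Suc k) + H * (\<tau> k)\<^sup>2" .
  qed
  also have "\<dots> = D 0 - D (Suc T) + H * (\<Sum>k=0..T. (\<tau> k)\<^sup>2)"
    by (simp add: sum.distrib sum_distrib_left sum_telescope atLeast0AtMost)
  also have "\<dots> \<le> (norm (x0 - xs))\<^sup>2 + H * (\<Sum>k=0..T. (\<tau> k)\<^sup>2)"
  proof -
    have "D (Suc T) \<ge> 0" by (simp add: D_def)
    then show ?thesis by (simp add: D_def x_0 gauss_seq.prob_space)
  qed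
  finally have "?m - M xs * \<sigma> \<le> ((norm (x0 - xs))\<^sup>2 + H * (\<Sum>k=0..T. (\<tau> k)\<^sup>2)) / (2 * ?S)"
    using S by (simp add: pos_le_divide_eq mult.commute)
  then show ?thesis by (simp add: e_def)
qed

end

theorem theorem4p5:
  fixes \<Omega> :: "(real^'d) set" and f :: "real^'d \<Rightarrow> real"
    and R1 R2 \<sigma> :: real and m :: nat
    and xstar x0 :: "real^'d" and \<tau> :: "nat \<Rightarrow> real"
    and x :: "nat \<Rightarrow> (nat \<Rightarrow> real^'d) \<Rightarrow> real^'d"
  assumes "\<Omega> \<noteq> {}" and "closed \<Omega>" and "convex \<Omega>"
    and "convex_on UNIV f" and "SPB f R1 R2 m"
    and "xstar \<in> \<Omega>" and "\<forall>y\<in>\<Omega>. f xstar \<le> f y"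
    and "\<sigma> > 0" and "x0 \<in> \<Omega>" and "\<forall>k. 0 < \<tau> k \<and> \<tau> k \<le> 1"
    and "\<forall>\<omega>. x 0 \<omega> = x0"
    and "\<forall>k \<omega>. x (Suc k) \<omega> = closest_point \<Omega>
           (x k \<omega> - (\<tau> k / (norm (x k \<omega>) ^ m + 1)) *\<^sub>R
              (((f (x k \<omega> + \<sigma> *\<^sub>R \<omega> k) - f (x k \<omega>)) / \<sigma>) *\<^sub>R \<omega> k))"
  defines "d \<equiv> real CARD('d)"
  defines "M \<equiv> \<lambda>y::real^'d. (2 powr (real m - 1) * R1 * norm y ^ m + R2) * sqrt d
                + 2 powr (real m - 1) * R1 * \<sigma> ^ m * (real m + 1 + d) powr ((real m + 1) / 2)"
  defines "H \<equiv> 3 * max (2 powr (2 * (real m - 1)) * R1\<^sup>2 * (4 + d)\<^sup>2)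
                  (R2\<^sup>2 * (4 + d)\<^sup>2 + 2 powr (2 * (real m - 1)) * R1\<^sup>2 * \<sigma> ^ (2 * m)
                     * (2 * real m + 4 + d) ^ (m + 2))"
  shows "(\<forall>z. (z \<in> \<Omega> \<and> (\<forall>u\<in>\<Omega>. gauss_smooth f \<sigma> z \<le> gauss_smooth f \<sigma> u)) \<longrightarrow>
            (\<forall>k. 0 \<le> (\<integral>\<omega>. (norm (x k \<omega> - z))\<^sup>2 \<partial>gauss_seq)
                     - (\<integral>\<omega>. (norm (x (Suc k) \<omega> - z))\<^sup>2 \<partial>gauss_seq) + H * (\<tau> k)\<^sup>2))
       \<and> (\<forall>T::nat. T > 0 \<longrightarrow>
            (MIN k\<in>{0..T}. \<integral>\<omega>. (f (x k \<omega>) - f xstar) / (norm (x k \<omega>) ^ m + 1) \<partial>gauss_seq)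
              \<le> 1 / (2 * (\<Sum>k=0..T. \<tau> k)) * ((norm (x0 - xstar))\<^sup>2 + H * (\<Sum>k=0..T. (\<tau> k)\<^sup>2))
                 + M xstar * \<sigma>)"
proof -
  interpret S: smoothed_convex_SPB f R1 R2 \<sigma> m
    by unfold_locales fact+
  interpret Z: zeroth_order_method f R1 R2 \<sigma> m \<Omega> x0 \<tau> x
    by unfold_locales (use assms in \<open>auto simp: S.v_def\<close>)
  \<comment> \<open>Squaring \<open>c\<close> doubles the exponent, which identifies the stated
    constants with those of the locale.\<close>
  have "2 powr (2 * (real m - 1)) * R1\<^sup>2 = S.c\<^sup>2"
    by (simp add: S.c_def power_mult_distrib powr_power mult.commute)
  then have H: "S.H = H"
    by (simp add: H_def S.H_def d_def)
  have M: "S.M y = M y" for y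
    by (simp add: M_def S.M_def S.c_def d_def)
  show ?thesis
  proof (intro conjI allI impI)
    fix z k assume "z \<in> \<Omega> \<and> (\<forall>u\<in>\<Omega>. gauss_smooth f \<sigma> z \<le> gauss_smooth f \<sigma> u)"
    then show "0 \<le> (\<integral>\<omega>. (norm (x k \<omega> - z))\<^sup>2 \<partial>gauss_seq)
        - (\<integral>\<omega>. (norm (x (Suc k) \<omega> - z))\<^sup>2 \<partial>gauss_seq) + H * (\<tau> k)\<^sup>2"
      using Z.smoothed_minimizer_descent[of z k] H by simp
  next
    fix T :: nat
    show "(MIN k\<in>{0..T}. \<integral>\<omega>. (f (x k \<omega>) - f xstar) / (norm (x k \<omega>) ^ m + 1) \<partial>gauss_seq)
        \<le> 1 / (2 * (\<Sum>k=0..T. \<tau> k)) * ((norm (x0 - xstar))\<^sup>2 + H * (\<Sum>k=0..T. (\<tau> k)\<^sup>2)) + M xstar * \<sigma>"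
      using Z.min_expected_gap_le[OF assms(6), of T] by (simp only: H M)
  qed
qed

end
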